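(* Let $X$ be a bounded geometry metric space and $A$ be a subspace of $X$. Let $1_A\in\ell^\infty(X)\subseteq C^*_u(X)$ denote the characteristic function of $A$, regarded as a diagonal projection. Then the following conditions are equivalent: (1) $A$ is a paradoxical subspace of $X$; (2) $1_A$ is a properly infinite projection in $C^*_u(X)$; (3) the $n$-fold direct sum $1_A\otimes 1_n$ is properly infinite in $M_n(C^*_u(X))$ for every $n\in\mathbb{N}$; (4) the $n$-fold direct sum $1_A\otimes 1_n$ is properly infinite in $M_n(C^*_u(X))$ for some $n\in\mathbb{N}$.
   Context: Here $\mathbb{N}=\{1,2,3,\dots\}$. A metric space $X$ has bounded geometry if for every $r>0$ there is a uniform (finite) bound on the cardinalities of all $r$-balls in $X$. The uniform Roe algebra $C^*_u(X)$ is the operator norm closure in $\mathcal{B}(\ell^2(X))$ of the $*$-algebra of $X$-by-$X$ complex matrices $(a_{xy})$ with uniformly bounded entries and finite propagation $\sup\{d(x,y)\mid a_{xy}\neq 0\}<\infty$; it contains $\ell^\infty(X)$ as diagonal matrices. A partial translation on $X$ is a bijection $t:A\to B$ between subsets $A,B\subseteq X$ with $\sup_{x\in A}d(x,t(x))<\infty$. A subspace $A\subseteq X$ is paradoxical if there are a decomposition $A=A_+\sqcup A_-$ and (bijective) partial translations $t_+:A\to A_+$ and $t_-:A\to A_-$. A projection $p$ in a $C^*$-algebra $B$ is properly infinite if there exist partial isometries $x,y\in B$ with $x^*x=y^*y=p$ and $xx^*+yy^*\le p$ (with this convention the zero projection counts as properly infinite). *)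

theory Defs
  imports "HOL-Analysis.Analysis" "HOL-Algebra.Ring"
begin

section \<open>The Hilbert space of square-summable complex functions\<close>

typedef 'a ell2 = "{f :: 'a \<Rightarrow> complex. (\<lambda>x. (cmod (f x))\<^sup>2) summable_on UNIV}"
  morphisms ell2_fun Abs_ell2
  by (rule exI[of _ "\<lambda>_. 0"]) simp

setup_lifting type_definition_ell2

lemma ell2_eqI: "(\<And>x. ell2_fun f x = ell2_fun g x) \<Longrightarrow> f = g"
  by (metis ell2_fun_inject ext)

lemma ell2_summable: "(\<lambda>x. (cmod (ell2_fun f x))\<^sup>2) summable_on UNIV"
  using ell2_fun[of f] by simp

lemma square_summable_mult_left:
  fixes f :: "'a \<Rightarrow> complex"
  assumes "(\<lambda>x. (cmod (f x))\<^sup>2) summable_on UNIV"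
  shows "(\<lambda>x. (cmod (c * f x))\<^sup>2) summable_on UNIV"
  using summable_on_cmult_right[OF assms, of "(cmod c)\<^sup>2"]
  by (simp add: norm_mult power_mult_distrib)

lemma square_summable_add:
  fixes f g :: "'a \<Rightarrow> complex"
  assumes "(\<lambda>x. (cmod (f x))\<^sup>2) summable_on UNIV" "(\<lambda>x. (cmod (g x))\<^sup>2) summable_on UNIV"
  shows "(\<lambda>x. (cmod (f x + g x))\<^sup>2) summable_on UNIV"
proof (rule summable_on_comparison_test)
  show "(\<lambda>x. 2 * (cmod (f x))\<^sup>2 + 2 * (cmod (g x))\<^sup>2) summable_on UNIV"
    by (intro summable_on_add summable_on_cmult_right assms)
  fix x
  have "(cmod (f x + g x))\<^sup>2 \<le> (cmod (f x) + cmod (g x))\<^sup>2"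
    by (intro power_mono norm_triangle_ineq) simp
  also have "\<dots> \<le> 2 * (cmod (f x))\<^sup>2 + 2 * (cmod (g x))\<^sup>2"
    using sum_squares_bound[of "cmod (f x)" "cmod (g x)"] by (simp add: power2_sum)
  finally show "(cmod (f x + g x))\<^sup>2 \<le> 2 * (cmod (f x))\<^sup>2 + 2 * (cmod (g x))\<^sup>2" .
qed simp

lemma square_summable_uminus:
  fixes f :: "'a \<Rightarrow> complex"
  assumes "(\<lambda>x. (cmod (f x))\<^sup>2) summable_on UNIV"
  shows "(\<lambda>x. (cmod (- f x))\<^sup>2) summable_on UNIV"
  using assms by simp

lemma square_summable_restrict:
  fixes f :: "'a \<Rightarrow> complex"
  assumes "(\<lambda>x. (cmod (f x))\<^sup>2) summable_on UNIV"
  shows "(\<lambda>x. (cmod (indicator A x * f x))\<^sup>2) summable_on UNIV"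
  by (rule summable_on_comparison_test[OF assms]) (auto simp: indicator_def)

lemma norm_mult_le_squares:
  "cmod a * cmod b \<le> (cmod a)\<^sup>2 + (cmod b)\<^sup>2"
proof -
  have "2 * (cmod a * cmod b) \<le> (cmod a)\<^sup>2 + (cmod b)\<^sup>2"
    using sum_squares_bound[of "cmod a" "cmod b"] by simp
  moreover have "0 \<le> cmod a * cmod b" by simp
  ultimately show ?thesis by linarith
qed

lemma ell2_inner_summable: "(\<lambda>x. ell2_fun f x \<bullet> ell2_fun g x) summable_on UNIV"
proof (rule Infinite_Sum.abs_summable_summable, rule Infinite_Sum.abs_summable_on_comparison_test')
  show "(\<lambda>x. (cmod (ell2_fun f x))\<^sup>2 + (cmod (ell2_fun g x))\<^sup>2) summable_on UNIV"
    by (intro summable_on_add ell2_summable)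
  show "norm (ell2_fun f x \<bullet> ell2_fun g x) \<le> (cmod (ell2_fun f x))\<^sup>2 + (cmod (ell2_fun g x))\<^sup>2" for x
    using Cauchy_Schwarz_ineq2[of "ell2_fun f x" "ell2_fun g x"]
      norm_mult_le_squares[of "ell2_fun f x" "ell2_fun g x"] by simp
qed

lemma ell2_cinner_summable: "(\<lambda>x. cnj (ell2_fun f x) * ell2_fun g x) summable_on UNIV"
proof (rule Infinite_Sum.abs_summable_summable, rule Infinite_Sum.abs_summable_on_comparison_test')
  show "(\<lambda>x. (cmod (ell2_fun f x))\<^sup>2 + (cmod (ell2_fun g x))\<^sup>2) summable_on UNIV"
    by (intro summable_on_add ell2_summable)
  show "norm (cnj (ell2_fun f x) * ell2_fun g x) \<le> (cmod (ell2_fun f x))\<^sup>2 + (cmod (ell2_fun g x))\<^sup>2" for x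
    using norm_mult_le_squares[of "ell2_fun f x" "ell2_fun g x"] by (simp add: norm_mult)
qed

instantiation ell2 :: (type) real_vector
begin

lift_definition zero_ell2 :: "'a ell2" is "\<lambda>_. 0" by simp
lift_definition plus_ell2 :: "'a ell2 \<Rightarrow> 'a ell2 \<Rightarrow> 'a ell2" is "\<lambda>f g x. f x + g x"
  by (rule square_summable_add)
lift_definition uminus_ell2 :: "'a ell2 \<Rightarrow> 'a ell2" is "\<lambda>f x. - f x"
  by (rule square_summable_uminus)
lift_definition minus_ell2 :: "'a ell2 \<Rightarrow> 'a ell2 \<Rightarrow> 'a ell2" is "\<lambda>f g x. f x - g x"
  using square_summable_add[OF _ square_summable_uminus] by force
lift_definition scaleR_ell2 :: "real \<Rightarrow> 'a ell2 \<Rightarrow> 'a ell2" is "\<lambda>r f x. of_real r * f x"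
  by (rule square_summable_mult_left)

instance
proof
  fix f g h :: "'a ell2" and r s :: real
  show "f + g + h = f + (g + h)" "f + g = g + f" "0 + f = f" "- f + f = 0" "f - g = f + - g"
    "r *\<^sub>R (f + g) = r *\<^sub>R f + r *\<^sub>R g" "(r + s) *\<^sub>R f = r *\<^sub>R f + s *\<^sub>R f"
    "r *\<^sub>R s *\<^sub>R f = (r * s) *\<^sub>R f" "1 *\<^sub>R f = f"
    by (rule ell2_eqI; transfer; simp add: algebra_simps)+
qed

end

text \<open>The real inner product is the real part of the complex one (\<open>cinner\<close> below), so that
  the norm and the operator norm of \<open>\<Rightarrow>\<^sub>L\<close> are the usual ones.\<close>

instantiation ell2 :: (type) real_inner
begin

definition inner_ell2 :: "'a ell2 \<Rightarrow> 'a ell2 \<Rightarrow> real" where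
  "inner_ell2 f g = (\<Sum>\<^sub>\<infinity>x. ell2_fun f x \<bullet> ell2_fun g x)"
definition norm_ell2 :: "'a ell2 \<Rightarrow> real" where
  "norm_ell2 f = sqrt (\<Sum>\<^sub>\<infinity>x. (cmod (ell2_fun f x))\<^sup>2)"
definition dist_ell2 :: "'a ell2 \<Rightarrow> 'a ell2 \<Rightarrow> real" where
  "dist_ell2 f g = norm (f - g)"
definition sgn_ell2 :: "'a ell2 \<Rightarrow> 'a ell2" where
  "sgn_ell2 f = inverse (norm f) *\<^sub>R f"
definition uniformity_ell2 :: "('a ell2 \<times> 'a ell2) filter" where
  "uniformity_ell2 = (INF e\<in>{0<..}. principal {(f, g). dist f g < e})"
definition open_ell2 :: "'a ell2 set \<Rightarrow> bool" where
  "open_ell2 U \<longleftrightarrow> (\<forall>f\<in>U. \<forall>\<^sub>F (f', g) in uniformity. f' = f \<longrightarrow> g \<in> U)"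

instance
proof
  fix f g h :: "'a ell2" and r :: real
  show "dist f g = norm (f - g)" by (rule dist_ell2_def)
  show "sgn f = f /\<^sub>R norm f" by (simp add: sgn_ell2_def)
  show "uniformity = (INF e\<in>{0<..}. principal {(f::'a ell2, g). dist f g < e})"
    by (rule uniformity_ell2_def)
  show "open U \<longleftrightarrow> (\<forall>f\<in>U. \<forall>\<^sub>F (f', g) in uniformity. f' = f \<longrightarrow> g \<in> U)" for U :: "'a ell2 set"
    by (rule open_ell2_def)
  show "inner f g = inner g f" by (simp add: inner_ell2_def inner_commute)
  show "inner (f + g) h = inner f h + inner g h"
    by (simp add: inner_ell2_def plus_ell2.rep_eq inner_add_left infsum_add ell2_inner_summable)
  have "(of_real r * ell2_fun f x) \<bullet> ell2_fun g x = r * (ell2_fun f x \<bullet> ell2_fun g x)" for x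
    by (simp flip: scaleR_conv_of_real)
  then show "inner (r *\<^sub>R f) g = r * inner f g"
    by (simp add: inner_ell2_def scaleR_ell2.rep_eq infsum_cmult_right')
  show "0 \<le> inner f f" by (simp add: inner_ell2_def infsum_nonneg)
  show "inner f f = 0 \<longleftrightarrow> f = 0"
  proof
    assume "inner f f = 0"
    then have "ell2_fun f x \<bullet> ell2_fun f x = 0" for x
      by (intro nonneg_infsum_le_0D[OF _ ell2_inner_summable]) (auto simp: inner_ell2_def)
    then show "f = 0" by (intro ell2_eqI) (simp add: zero_ell2.rep_eq)
  qed (simp add: inner_ell2_def zero_ell2.rep_eq)
  show "norm f = sqrt (inner f f)"
    by (simp add: norm_ell2_def inner_ell2_def power2_norm_eq_inner)
qed

end

lift_definition scaleC :: "complex \<Rightarrow> 'a ell2 \<Rightarrow> 'a ell2" is "\<lambda>c f x. c * f x"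
  by (rule square_summable_mult_left)

definition cinner :: "'a ell2 \<Rightarrow> 'a ell2 \<Rightarrow> complex" where
  "cinner f g = (\<Sum>\<^sub>\<infinity>x. cnj (ell2_fun f x) * ell2_fun g x)"

section \<open>Operators and their matrices\<close>

text \<open>\<^typ>\<open>'a ell2 \<Rightarrow>\<^sub>L 'a ell2\<close> consists of the bounded real-linear operators. Complex linearity
  enters through \<open>has_matrix\<close>, and it is preserved by norm limits.\<close>

definition clinear_op :: "('a ell2 \<Rightarrow>\<^sub>L 'a ell2) \<Rightarrow> bool" where
  "clinear_op T \<longleftrightarrow> (\<forall>c f. T (scaleC c f) = scaleC c (T f))"

text \<open>Well defined for complex-linear \<open>T\<close>: see \<open>adj_cinner\<close> below.\<close>

definition adj :: "('a ell2 \<Rightarrow>\<^sub>L 'a ell2) \<Rightarrow> ('a ell2 \<Rightarrow>\<^sub>L 'a ell2)" where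
  "adj T = (THE S. \<forall>f g. cinner (T f) g = cinner f (blinfun_apply S g))"

text \<open>Used only for matrices with finitely supported rows, where the sum is finite.\<close>

definition has_matrix :: "('a ell2 \<Rightarrow>\<^sub>L 'a ell2) \<Rightarrow> ('a \<Rightarrow> 'a \<Rightarrow> complex) \<Rightarrow> bool" where
  "has_matrix T a \<longleftrightarrow> (\<forall>f x. ell2_fun (T f) x = (\<Sum>\<^sub>\<infinity>y. a x y * ell2_fun f y))"

lift_definition ell2_restrict :: "'a set \<Rightarrow> 'a ell2 \<Rightarrow> 'a ell2" is "\<lambda>A f x. indicator A x * f x"
  by (rule square_summable_restrict)

lemma norm_ell2_sq: "(norm f)\<^sup>2 = (\<Sum>\<^sub>\<infinity>x. (cmod (ell2_fun f x))\<^sup>2)"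
  by (simp add: norm_ell2_def infsum_nonneg)

lemma norm_ell2_restrict_le: "norm (ell2_restrict A f) \<le> norm f"
proof -
  have "(norm (ell2_restrict A f))\<^sup>2 \<le> (norm f)\<^sup>2"
    unfolding norm_ell2_sq
    by (rule infsum_mono[OF ell2_summable ell2_summable])
      (auto simp: ell2_restrict.rep_eq indicator_def)
  then show ?thesis by (rule power2_le_imp_le) simp
qed

text \<open>The diagonal operator given by the characteristic function of \<open>A\<close>.\<close>

lift_definition char_proj :: "'a set \<Rightarrow> 'a ell2 \<Rightarrow>\<^sub>L 'a ell2" is ell2_restrict
proof (rule bounded_linear_intro[where K = 1])
  fix A :: "'a set" and f g :: "'a ell2" and r :: real
  show "ell2_restrict A (f + g) = ell2_restrict A f + ell2_restrict A g"
    by (rule ell2_eqI) (simp add: ell2_restrict.rep_eq plus_ell2.rep_eq algebra_simps)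
  show "ell2_restrict A (r *\<^sub>R f) = r *\<^sub>R ell2_restrict A f"
    by (rule ell2_eqI) (simp add: ell2_restrict.rep_eq scaleR_ell2.rep_eq)
  show "norm (ell2_restrict A f) \<le> norm f * 1"
    by (simp add: norm_ell2_restrict_le)
qed

section \<open>Coarse geometry\<close>

definition bounded_geometry :: "'a::metric_space set \<Rightarrow> bool" where
  "bounded_geometry X \<longleftrightarrow>
     (\<forall>r>0. \<exists>N. \<forall>x\<in>X. finite (cball x r \<inter> X) \<and> card (cball x r \<inter> X) \<le> N)"

definition partial_translation :: "('a::metric_space \<Rightarrow> 'a) \<Rightarrow> 'a set \<Rightarrow> 'a set \<Rightarrow> bool" where
  "partial_translation t A B \<longleftrightarrow> bij_betw t A B \<and> bdd_above ((\<lambda>x. dist x (t x)) ` A)"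

definition paradoxical :: "'a::metric_space set \<Rightarrow> bool" where
  "paradoxical A \<longleftrightarrow> (\<exists>Ap Am tp tm. A = Ap \<union> Am \<and> Ap \<inter> Am = {} \<and>
     partial_translation tp A Ap \<and> partial_translation tm A Am)"

definition roe_matrix :: "('a::metric_space \<Rightarrow> 'a \<Rightarrow> complex) \<Rightarrow> bool" where
  "roe_matrix a \<longleftrightarrow> bdd_above {cmod (a x y) | x y. True} \<and> bdd_above {dist x y | x y. a x y \<noteq> 0}"

section \<open>Star rings, matrices and properly infinite projections\<close>

text \<open>The notions of a projection, a partial isometry and the order of a C*-algebra only involve
  the underlying ring and involution.\<close>

record 'b star_ring = "'b ring" + star :: "'b \<Rightarrow> 'b"

definition is_projection :: "('b, 'm) star_ring_scheme \<Rightarrow> 'b \<Rightarrow> bool" where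
  "is_projection B p \<longleftrightarrow> p \<in> carrier B \<and> star B p = p \<and> p \<otimes>\<^bsub>B\<^esub> p = p"

definition partial_isometry :: "('b, 'm) star_ring_scheme \<Rightarrow> 'b \<Rightarrow> bool" where
  "partial_isometry B x \<longleftrightarrow> x \<in> carrier B \<and> x \<otimes>\<^bsub>B\<^esub> star B x \<otimes>\<^bsub>B\<^esub> x = x"

text \<open>\<open>a \<le> b\<close> iff \<open>b - a\<close> is positive, that is, of the form \<open>z\<^sup>* z\<close> with \<open>z\<close> in the algebra.\<close>

definition star_le :: "('b, 'm) star_ring_scheme \<Rightarrow> 'b \<Rightarrow> 'b \<Rightarrow> bool" where
  "star_le B a b \<longleftrightarrow> a \<in> carrier B \<and> b \<in> carrier B \<and>
     (\<exists>z\<in>carrier B. b \<ominus>\<^bsub>B\<^esub> a = star B z \<otimes>\<^bsub>B\<^esub> z)"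

definition properly_infinite :: "('b, 'm) star_ring_scheme \<Rightarrow> 'b \<Rightarrow> bool" where
  "properly_infinite B p \<longleftrightarrow> is_projection B p \<and>
     (\<exists>x y. partial_isometry B x \<and> partial_isometry B y \<and>
        star B x \<otimes>\<^bsub>B\<^esub> x = p \<and> star B y \<otimes>\<^bsub>B\<^esub> y = p \<and>
        star_le B (x \<otimes>\<^bsub>B\<^esub> star B x \<oplus>\<^bsub>B\<^esub> y \<otimes>\<^bsub>B\<^esub> star B y) p)"

text \<open>\<open>M\<^sub>n(B)\<close>, with matrices as extensional functions on \<open>{..<n} \<times> {..<n}\<close>.\<close>

definition mat_of :: "nat \<Rightarrow> (nat \<Rightarrow> nat \<Rightarrow> 'b) \<Rightarrow> nat \<Rightarrow> nat \<Rightarrow> 'b" where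
  "mat_of n m = (\<lambda>i\<in>{..<n}. \<lambda>j\<in>{..<n}. m i j)"

definition mat_direct_sum :: "('b, 'm) star_ring_scheme \<Rightarrow> nat \<Rightarrow> 'b \<Rightarrow> nat \<Rightarrow> nat \<Rightarrow> 'b" where
  "mat_direct_sum B n p = mat_of n (\<lambda>i j. if i = j then p else \<zero>\<^bsub>B\<^esub>)"

definition mat_star_ring :: "('b, 'm) star_ring_scheme \<Rightarrow> nat \<Rightarrow> (nat \<Rightarrow> nat \<Rightarrow> 'b) star_ring" where
  "mat_star_ring B n = \<lparr>
     carrier = {..<n} \<rightarrow>\<^sub>E {..<n} \<rightarrow>\<^sub>E carrier B,
     mult = (\<lambda>a b. mat_of n (\<lambda>i j. \<Oplus>\<^bsub>B\<^esub>k\<in>{..<n}. a i k \<otimes>\<^bsub>B\<^esub> b k j)),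
     one = mat_direct_sum B n \<one>\<^bsub>B\<^esub>,
     zero = mat_of n (\<lambda>i j. \<zero>\<^bsub>B\<^esub>),
     add = (\<lambda>a b. mat_of n (\<lambda>i j. a i j \<oplus>\<^bsub>B\<^esub> b i j)),
     star = (\<lambda>a. mat_of n (\<lambda>i j. star B (a j i)))\<rparr>"

section \<open>The uniform Roe algebra\<close>

text \<open>The closure is taken in the operator norm topology of \<^typ>\<open>'a ell2 \<Rightarrow>\<^sub>L 'a ell2\<close>. In bounded
  geometry every matrix satisfying \<open>roe_matrix\<close> defines a bounded operator: see
  \<open>roe_matrix_has_operator\<close> below.\<close>

definition uniform_roe_algebra :: "('a::metric_space ell2 \<Rightarrow>\<^sub>L 'a ell2) star_ring" where
  "uniform_roe_algebra = \<lparr>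
     carrier = closure {T. \<exists>a. roe_matrix a \<and> has_matrix T a},
     mult = (o\<^sub>L),
     one = id_blinfun,
     zero = 0,
     add = (+),
     star = adj\<rparr>"

section \<open>Well-definedness\<close>

lemma has_matrix_char_proj: "has_matrix (char_proj A) (\<lambda>x y. if x = y then indicator A x else 0)"
  unfolding has_matrix_def
proof (intro allI)
  fix f :: "'a ell2" and x
  have "((\<lambda>y. (if x = y then indicator A x else 0) * ell2_fun f y) has_sum
     indicator A x * ell2_fun f x) UNIV"
    by (rule has_sum_finite_neutralI[of "{x}"]) (auto simp: indicator_def)
  then show "ell2_fun (char_proj A f) x =
      (\<Sum>\<^sub>\<infinity>y. (if x = y then indicator A x else 0) * ell2_fun f y)"
    by (simp add: char_proj.rep_eq ell2_restrict.rep_eq infsumI)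
qed

lemma has_matrix_unique:
  assumes "has_matrix S a" "has_matrix T a"
  shows "S = T"
  using assms by (intro blinfun_eqI ell2_eqI) (simp add: has_matrix_def)

lemma clinear_op_has_matrix:
  assumes "has_matrix T a"
  shows "clinear_op T"
  unfolding clinear_op_def
proof (intro allI ell2_eqI)
  fix c f x
  have "(\<Sum>\<^sub>\<infinity>y. a x y * (c * ell2_fun f y)) = (\<Sum>\<^sub>\<infinity>y. c * (a x y * ell2_fun f y))"
    by (simp add: mult.left_commute)
  then show "ell2_fun (T (scaleC c f)) x = ell2_fun (scaleC c (T f)) x"
    using assms by (simp add: has_matrix_def scaleC.rep_eq infsum_cmult_right')
qed

lemma norm_scaleC [simp]: "norm (scaleC c f) = cmod c * norm f"
  by (simp add: norm_ell2_def scaleC.rep_eq norm_mult power_mult_distrib infsum_cmult_right'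
      real_sqrt_mult)

lemma Re_cinner: "Re (cinner f g) = inner f g"
  unfolding cinner_def inner_ell2_def
  by (subst infsum_Re[symmetric, OF ell2_cinner_summable]) (simp add: inner_complex_def)

lemma cinner_simps:
  "cinner (f + f') g = cinner f g + cinner f' g"
  "cinner f (g + g') = cinner f g + cinner f g'"
  "cinner (f - f') g = cinner f g - cinner f' g"
  "cinner f (g - g') = cinner f g - cinner f g'"
  "cinner (scaleC c f) g = cnj c * cinner f g"
  "cinner f (scaleC c g) = c * cinner f g"
  "cinner 0 g = 0" "cinner f 0 = 0"
proof -
  note [simp] = plus_ell2.rep_eq scaleC.rep_eq zero_ell2.rep_eq
  show add: "cinner (f + f') g = cinner f g + cinner f' g" for f f'
    by (simp add: cinner_def distrib_right infsum_add ell2_cinner_summable)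
  show add': "cinner f (g + g') = cinner f g + cinner f g'" for g g'
    by (simp add: cinner_def distrib_left infsum_add ell2_cinner_summable)
  show "cinner (f - f') g = cinner f g - cinner f' g"
    using add[of "f - f'" f'] by simp
  show "cinner f (g - g') = cinner f g - cinner f g'"
    using add'[of "g - g'" g'] by simp
  show "cinner (scaleC c f) g = cnj c * cinner f g"
    by (simp add: cinner_def mult.assoc infsum_cmult_right')
  show "cinner f (scaleC c g) = c * cinner f g"
    by (simp add: cinner_def mult.left_commute infsum_cmult_right')
qed (simp_all add: cinner_def zero_ell2.rep_eq)

lemma cinner_Cauchy_Schwarz: "cmod (cinner f g) \<le> norm f * norm g"
proof (cases "cinner f g = 0")
  case False
  define u where "u = cinner f g / cmod (cinner f g)"
  have u: "cmod u = 1" using False by (simp add: u_def norm_divide)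
  have "cnj (cinner f g) * cinner f g = complex_of_real ((cmod (cinner f g))\<^sup>2)"
    by (metis complex_norm_square mult.commute)
  then have "cinner (scaleC u f) g = cmod (cinner f g)"
    using False by (simp add: cinner_simps u_def power2_eq_square)
  then have "cmod (cinner f g) = inner (scaleC u f) g"
    by (metis Re_cinner Re_complex_of_real)
  also have "\<dots> \<le> norm (scaleC u f) * norm g" by (rule norm_cauchy_schwarz)
  finally show ?thesis by (simp add: u)
qed simp

lemma cinner_eqI:
  assumes "\<And>f. cinner f g = cinner f h"
  shows "g = h"
proof -
  have "cinner (g - h) (g - h) = 0" using assms by (simp add: cinner_simps)
  then have "inner (g - h) (g - h) = 0" by (metis Re_cinner zero_complex.sel(1))
  then show ?thesis by simp
qed

lift_definition basis_ell2 :: "'a \<Rightarrow> 'a ell2" is "\<lambda>y x. indicator {y} x"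
proof -
  fix y :: 'a
  show "(\<lambda>x. (cmod (indicator {y} x))\<^sup>2) summable_on UNIV"
    by (rule has_sum_imp_summable, rule has_sum_finite_neutralI[of "{y}"]) auto
qed

lemma ell2_fun_sum: "ell2_fun (\<Sum>x\<in>F. h x) y = (\<Sum>x\<in>F. ell2_fun (h x) y)"
  by (induction F rule: infinite_finite_induct) (auto simp: zero_ell2.rep_eq plus_ell2.rep_eq)

lemma cinner_sum_left: "cinner (\<Sum>x\<in>F. h x) g = (\<Sum>x\<in>F. cinner (h x) g)"
  by (induction F rule: infinite_finite_induct) (auto simp: cinner_simps)

lemma cinner_basis: "cinner (basis_ell2 x) g = ell2_fun g x"
  unfolding cinner_def
  by (rule infsumI, rule has_sum_finite_neutralI[of "{x}"]) (auto simp: basis_ell2.rep_eq)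

lemma ell2_fun_comb:
  assumes "finite F"
  shows "ell2_fun (\<Sum>x\<in>F. scaleC (c x) (basis_ell2 x)) y = (if y \<in> F then c y else 0)"
proof -
  have "ell2_fun (\<Sum>x\<in>F. scaleC (c x) (basis_ell2 x)) y = (\<Sum>x\<in>F. if x = y then c x else 0)"
    unfolding ell2_fun_sum
    by (rule sum.cong) (auto simp: scaleC.rep_eq basis_ell2.rep_eq)
  then show ?thesis using assms by (simp add: sum.delta)
qed

lemma norm_comb_sq:
  assumes "finite F"
  shows "(norm (\<Sum>x\<in>F. scaleC (c x) (basis_ell2 x)))\<^sup>2 = (\<Sum>x\<in>F. (cmod (c x))\<^sup>2)"
  unfolding norm_ell2_sq
  by (rule infsumI, rule has_sum_finite_neutralI[of F]) (auto simp: ell2_fun_comb assms)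

lemma ell2_approx:
  assumes "0 < e"
  obtains F where "finite F" "norm (f - (\<Sum>x\<in>F. scaleC (ell2_fun f x) (basis_ell2 x))) \<le> e"
proof -
  let ?s = "\<lambda>x. (cmod (ell2_fun f x))\<^sup>2"
  have "0 < e\<^sup>2" using assms by simp
  then obtain F where F: "finite F" "dist (sum ?s F) (infsum ?s UNIV) \<le> e\<^sup>2"
    using infsum_finite_approximation[OF ell2_summable, of "e\<^sup>2" f] by blast
  let ?g = "f - (\<Sum>x\<in>F. scaleC (ell2_fun f x) (basis_ell2 x))"
  have g: "ell2_fun ?g y = (if y \<in> F then 0 else ell2_fun f y)" for y
    by (simp add: minus_ell2.rep_eq ell2_fun_comb F(1))
  have h: "((\<lambda>y. if y \<in> F then ?s y else 0) has_sum sum ?s F) UNIV"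
    by (rule has_sum_finite_neutralI[OF F(1)]) auto
  have "(norm ?g)\<^sup>2 + sum ?s F =
      (\<Sum>\<^sub>\<infinity>y. (cmod (ell2_fun ?g y))\<^sup>2 + (if y \<in> F then ?s y else 0))"
    unfolding norm_ell2_sq
    by (subst infsum_add) (use ell2_summable[of ?g] h in \<open>auto simp: has_sum_iff\<close>)
  also have "\<dots> = infsum ?s UNIV" by (rule infsum_cong) (simp add: g)
  finally have "(norm ?g)\<^sup>2 \<le> e\<^sup>2" using F(2) by (simp add: dist_real_def)
  then have "norm ?g \<le> e" using assms by (simp add: power2_le_iff_abs_le)
  with F(1) show thesis by (rule that)
qed

lemma adj_exists:
  assumes T: "clinear_op T"
  shows "\<exists>S. \<forall>f g. cinner (T f) g = cinner f (blinfun_apply S g)"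
proof -
  define c where "c g x = cinner (T (basis_ell2 x)) g" for g x
  have fin: "cinner (T (\<Sum>x\<in>F. scaleC (d x) (basis_ell2 x))) g = (\<Sum>x\<in>F. cnj (d x) * c g x)"
    for F d g
    using T by (simp add: blinfun.sum_right clinear_op_def cinner_sum_left cinner_simps c_def)
  have bound: "(\<Sum>x\<in>F. (cmod (c g x))\<^sup>2) \<le> (norm T * norm g)\<^sup>2" if F: "finite F" for F g
  proof -
    define v where "v = (\<Sum>x\<in>F. scaleC (c g x) (basis_ell2 x))"
    define s where "s = (\<Sum>x\<in>F. (cmod (c g x))\<^sup>2)"
    have v: "(norm v)\<^sup>2 = s" unfolding v_def s_def by (rule norm_comb_sq[OF F])
    have "cinner (T v) g = complex_of_real s"
      unfolding v_def fin s_def of_real_sum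
      by (rule sum.cong) (metis complex_norm_square mult.commute, metis complex_norm_square mult.commute)
    then have "s \<le> norm (T v) * norm g"
      using cinner_Cauchy_Schwarz[of "T v" g] by simp
    also have "\<dots> \<le> (norm T * norm v) * norm g"
      by (intro mult_right_mono norm_blinfun) simp
    finally have "norm v * norm v \<le> norm v * (norm T * norm g)"
      by (simp add: v[symmetric] power2_eq_square mult.commute mult.left_commute)
    then have "norm v \<le> norm T * norm g"
      by (cases "norm v = 0") (auto dest: mult_left_le_imp_le)
    then have "(norm v)\<^sup>2 \<le> (norm T * norm g)\<^sup>2" by (intro power_mono) auto
    then show ?thesis by (simp add: v s_def)
  qed
  have sq: "(\<lambda>x. (cmod (c g x))\<^sup>2) summable_on UNIV" for g
    by (rule nonneg_bdd_above_summable_on) (auto intro!: bdd_aboveI2 bound)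
  define S where "S g = Abs_ell2 (c g)" for g
  have S: "ell2_fun (S g) x = c g x" for g x
    unfolding S_def by (subst Abs_ell2_inverse) (auto simp: sq)
  have "bounded_linear S"
  proof (rule bounded_linear_intro)
    show "S (g + h) = S g + S h" for g h
      by (rule ell2_eqI) (simp add: S plus_ell2.rep_eq c_def cinner_simps)
    have "r *\<^sub>R g = scaleC (of_real r) g" for r :: real and g :: "'a ell2"
      by (rule ell2_eqI) (simp add: scaleR_ell2.rep_eq scaleC.rep_eq)
    then show "S (r *\<^sub>R g) = r *\<^sub>R S g" for r g
      by (intro ell2_eqI) (simp add: S scaleC.rep_eq c_def cinner_simps)
    have "(norm (S g))\<^sup>2 \<le> (norm T * norm g)\<^sup>2" for g
      unfolding norm_ell2_sq S by (rule infsum_le_finite_sums[OF sq bound])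
    then show "norm (S g) \<le> norm g * norm T" for g
      by (metis mult.commute norm_ge_zero power2_le_imp_le zero_le_mult_iff)
  qed
  then have app: "blinfun_apply (Blinfun S) = S" by (rule bounded_linear_Blinfun_apply)
  have "cinner (T f) g = cinner f (S g)" for f g
  proof -
    define K where "K = norm T * norm g + norm (S g)"
    have K: "0 \<le> K" by (simp add: K_def)
    have "cmod (cinner (T f) g - cinner f (S g)) \<le> e * K" if e: "0 < e" for e
    proof -
      obtain F where F: "finite F" "norm (f - (\<Sum>x\<in>F. scaleC (ell2_fun f x) (basis_ell2 x))) \<le> e"
        using ell2_approx[OF e] .
      define v where "v = (\<Sum>x\<in>F. scaleC (ell2_fun f x) (basis_ell2 x))"
      have "cinner (T v) g = cinner v (S g)"
        unfolding v_def fin cinner_sum_left by (simp add: cinner_simps cinner_basis S)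
      then have "cinner (T f) g - cinner f (S g) = cinner (T (f - v)) g - cinner (f - v) (S g)"
        by (simp add: blinfun.diff_right cinner_simps)
      also have "cmod \<dots> \<le> norm (T (f - v)) * norm g + norm (f - v) * norm (S g)"
        by (intro order_trans[OF norm_triangle_ineq4] add_mono cinner_Cauchy_Schwarz)
      also have "\<dots> \<le> (norm T * norm (f - v)) * norm g + norm (f - v) * norm (S g)"
        by (intro add_right_mono mult_right_mono norm_blinfun) simp
      also have "\<dots> = norm (f - v) * K" by (simp add: K_def algebra_simps)
      also have "\<dots> \<le> e * K" using F(2) K by (intro mult_right_mono) (simp_all add: v_def)
      finally show ?thesis .
    qed
    note * = this
    have "cmod (cinner (T f) g - cinner f (S g)) \<le> 0"
    proof (rule field_le_epsilon)
      fix d :: real assume d: "0 < d"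
      have "d / (K + 1) * K \<le> d" using d K by (simp add: field_simps)
      then show "cmod (cinner (T f) g - cinner f (S g)) \<le> 0 + d"
        using *[of "d / (K + 1)"] d K by simp
    qed
    then show ?thesis by simp
  qed
  then show ?thesis using app by metis
qed

lemma adj_cinner:
  assumes "clinear_op T"
  shows "cinner (T f) g = cinner f (adj T g)"
proof -
  have "\<exists>!S. \<forall>f g. cinner (T f) g = cinner f (blinfun_apply S g)"
    by (rule ex_ex1I[OF adj_exists[OF assms]]) (metis blinfun_eqI cinner_eqI)
  from theI'[OF this] show ?thesis unfolding adj_def by blast
qed

lemma closed_clinear_op: "closed {T. clinear_op T}"
proof -
  have "bounded_linear (scaleC c :: 'a ell2 \<Rightarrow> _)" for c
  proof (rule bounded_linear_intro[where K = "cmod c"])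
    show "scaleC c (f + g) = scaleC c f + scaleC c g" for f g :: "'a ell2"
      by (rule ell2_eqI) (simp add: scaleC.rep_eq plus_ell2.rep_eq algebra_simps)
    show "scaleC c (r *\<^sub>R f) = r *\<^sub>R scaleC c f" for r and f :: "'a ell2"
      by (rule ell2_eqI) (simp add: scaleC.rep_eq scaleR_ell2.rep_eq)
  qed simp
  then have "closed {T :: 'a ell2 \<Rightarrow>\<^sub>L 'a ell2. T (scaleC c f) = scaleC c (T f)}" for c f
    by (intro closed_Collect_eq bounded_linear.continuous_on[OF _ blinfun.continuous_on]
        blinfun.continuous_on continuous_on_id continuous_on_const)
  then show ?thesis
    unfolding clinear_op_def by (intro closed_Collect_all)
qed

lemma uniform_roe_algebra_clinear_op:
  "T \<in> carrier uniform_roe_algebra \<Longrightarrow> clinear_op T"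
proof -
  have "{T :: 'a ell2 \<Rightarrow>\<^sub>L 'a ell2. \<exists>a. roe_matrix a \<and> has_matrix T a} \<subseteq> {T. clinear_op T}"
    using clinear_op_has_matrix by blast
  from closure_minimal[OF this closed_clinear_op]
  show "T \<in> carrier uniform_roe_algebra \<Longrightarrow> clinear_op T"
    by (auto simp: uniform_roe_algebra_def)
qed

lemma roe_matrix_has_operator:
  fixes a :: "'a::metric_space \<Rightarrow> 'a \<Rightarrow> complex"
  assumes X: "bounded_geometry (UNIV :: 'a set)" and a: "roe_matrix a"
  shows "\<exists>T. has_matrix T a"
proof -
  have "bdd_above {cmod (a x y) | x y. True}" "bdd_above {dist x y | x y. a x y \<noteq> 0}"
    using a by (simp_all add: roe_matrix_def)
  then obtain M r0 where M': "\<forall>t\<in>{cmod (a x y) | x y. True}. t \<le> M"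
    and r0': "\<forall>t\<in>{dist x y | x y. a x y \<noteq> 0}. t \<le> r0"
    unfolding bdd_above_def by blast
  from M' have M: "cmod (a x y) \<le> M" for x y by blast
  have M0: "0 \<le> M" using M[of undefined undefined] norm_ge_zero order_trans by blast
  from r0' have r0: "a x y \<noteq> 0 \<Longrightarrow> dist x y \<le> r0" for x y by blast
  define r where "r = max r0 1"
  have r: "a x y = 0" if "y \<notin> cball x r" for x y
    using r0[of x y] that by (cases "a x y = 0") (auto simp: r_def max_def split: if_splits)
  obtain N where N: "\<And>x::'a. finite (cball x r)" "\<And>x::'a. card (cball x r) \<le> N"
  proof -
    have "0 < r" by (simp add: r_def)
    with X that show thesis unfolding bounded_geometry_def by (simp, meson)
  qed
  define h where "h f x = (\<Sum>y\<in>cball x r. a x y * ell2_fun f y)" for f x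
  have h: "(\<Sum>\<^sub>\<infinity>y. a x y * ell2_fun f y) = h f x" for f x
    by (rule infsumI, rule has_sum_finite_neutralI[OF N(1)]) (auto simp: h_def r)
  define C where "C = real N * M\<^sup>2 * real N"
  have pt: "(cmod (h f x))\<^sup>2 \<le> real N * M\<^sup>2 * (\<Sum>y\<in>cball x r. (cmod (ell2_fun f y))\<^sup>2)" for f x
  proof -
    let ?S = "\<Sum>y\<in>cball x r. cmod (ell2_fun f y)"
    have "cmod (h f x) \<le> (\<Sum>y\<in>cball x r. cmod (a x y * ell2_fun f y))"
      unfolding h_def by (rule norm_sum)
    also have "\<dots> \<le> (\<Sum>y\<in>cball x r. M * cmod (ell2_fun f y))"
      by (intro sum_mono) (simp add: norm_mult mult_right_mono M)
    also have "\<dots> = M * ?S" by (simp add: sum_distrib_left)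
    finally have "(cmod (h f x))\<^sup>2 \<le> (M * ?S)\<^sup>2" by (intro power_mono) auto
    also have "\<dots> = M\<^sup>2 * ?S\<^sup>2" by (simp add: power_mult_distrib)
    also have "?S\<^sup>2 \<le> real (card (cball x r)) * (\<Sum>y\<in>cball x r. (cmod (ell2_fun f y))\<^sup>2)"
      using sum_squared_le_sum_of_squares[of "\<lambda>y. cmod (ell2_fun f y)" "cball x r"]
      by (simp add: mult.commute)
    also have "\<dots> \<le> real N * (\<Sum>y\<in>cball x r. (cmod (ell2_fun f y))\<^sup>2)"
      using N(2)[of x] by (intro mult_right_mono sum_nonneg) auto
    finally show ?thesis by (simp add: mult_left_mono mult.assoc mult.left_commute)
  qed
  have bound: "(\<Sum>x\<in>F. (cmod (h f x))\<^sup>2) \<le> C * (norm f)\<^sup>2" if F: "finite F" for F f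
  proof -
    let ?s = "\<lambda>y. (cmod (ell2_fun f y))\<^sup>2"
    define U where "U = (\<Union>x\<in>F. cball x r)"
    have U: "finite U" using F N(1) by (simp add: U_def)
    have "(\<Sum>x\<in>F. \<Sum>y\<in>cball x r. ?s y) = (\<Sum>x\<in>F. \<Sum>y\<in>U. if y \<in> cball x r then ?s y else 0)"
      using U by (intro sum.cong refl sum.mono_neutral_cong_left) (auto simp: U_def)
    also have "\<dots> = (\<Sum>y\<in>U. \<Sum>x\<in>F. if y \<in> cball x r then ?s y else 0)"
      by (rule sum.swap)
    also have "\<dots> \<le> (\<Sum>y\<in>U. real N * ?s y)"
    proof (rule sum_mono)
      fix y
      have "(\<Sum>x\<in>F. if y \<in> cball x r then ?s y else 0) = (\<Sum>x\<in>F \<inter> cball y r. ?s y)"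
        using sum.inter_restrict[OF F, of "\<lambda>_. ?s y" "cball y r"] by (simp add: dist_commute)
      also have "\<dots> = real (card (F \<inter> cball y r)) * ?s y" by simp
      also have "\<dots> \<le> real N * ?s y"
        using card_mono[OF N(1), of "F \<inter> cball y r" y] N(2)[of y]
        by (intro mult_right_mono) auto
      finally show "(\<Sum>x\<in>F. if y \<in> cball x r then ?s y else 0) \<le> real N * ?s y" .
    qed
    also have "\<dots> = real N * sum ?s U" by (simp add: sum_distrib_left)
    also have "\<dots> \<le> real N * (norm f)\<^sup>2"
      unfolding norm_ell2_sq
      by (intro mult_left_mono finite_sum_le_infsum[OF ell2_summable U]) auto
    finally have *: "(\<Sum>x\<in>F. \<Sum>y\<in>cball x r. ?s y) \<le> real N * (norm f)\<^sup>2" .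
    have "(\<Sum>x\<in>F. (cmod (h f x))\<^sup>2) \<le> real N * M\<^sup>2 * (\<Sum>x\<in>F. \<Sum>y\<in>cball x r. ?s y)"
      unfolding sum_distrib_left[of "real N * M\<^sup>2" _ F] by (intro sum_mono pt)
    also have "\<dots> \<le> real N * M\<^sup>2 * (real N * (norm f)\<^sup>2)"
      by (intro mult_left_mono *) auto
    finally show ?thesis by (simp add: C_def mult.assoc)
  qed
  have C: "0 \<le> C" by (simp add: C_def)
  have sq: "(\<lambda>x. (cmod (h f x))\<^sup>2) summable_on UNIV" for f
    by (rule nonneg_bdd_above_summable_on) (auto intro!: bdd_aboveI2 bound)
  define S where "S f = Abs_ell2 (h f)" for f
  have S: "ell2_fun (S f) x = h f x" for f x
    unfolding S_def by (subst Abs_ell2_inverse) (auto simp: sq)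
  have "bounded_linear S"
  proof (rule bounded_linear_intro)
    show "S (f + g) = S f + S g" for f g
      by (rule ell2_eqI) (simp add: S plus_ell2.rep_eq h_def distrib_left sum.distrib)
    show "S (c *\<^sub>R f) = c *\<^sub>R S f" for c f
      by (rule ell2_eqI) (simp add: S scaleR_ell2.rep_eq h_def sum_distrib_left mult.left_commute)
    have "(norm (S f))\<^sup>2 \<le> (norm f * sqrt C)\<^sup>2" for f
      unfolding norm_ell2_sq[of "S f"] S
      by (rule infsum_le_finite_sums[OF sq]) (use bound[of _ f] C in \<open>simp add: power_mult_distrib mult.commute\<close>)
    then show "norm (S f) \<le> norm f * sqrt C" for f
      using C by (meson mult_nonneg_nonneg norm_ge_zero power2_le_imp_le real_sqrt_ge_zero)
  qed
  then have "has_matrix (Blinfun S) a"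
    by (simp add: has_matrix_def bounded_linear_Blinfun_apply S h)
  then show ?thesis ..
qed

end

theory Submission
  imports Defs
begin

text \<open>
  A paradoxical decomposition gives two isometries of \<open>\<ell>\<^sup>2(A)\<close> with complementary ranges, and the
  diagonal embedding passes proper infiniteness on to all matrix algebras. Conversely, let \<open>x\<close>, \<open>y\<close>
  witness that \<open>1\<^sub>A \<otimes> 1\<^sub>n\<close> is properly infinite. Counting squared matrix coefficients, the columns
  of \<open>x\<close> and \<open>y\<close> over a finite \<open>F \<subseteq> A\<close> have total mass \<open>2n|F|\<close>, while the rows over any
  \<open>G \<subseteq> A\<close> carry at most \<open>n|G|\<close>. By approximation with operators of finite propagation, most of the
  mass of the columns lies in the rows over the \<open>R\<close>-neighbourhood of \<open>F\<close> in \<open>A\<close>, which therefore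
  has at least \<open>3/2 |F|\<close> points. Iterating once, the \<open>2R\<close>-neighbourhood has at least \<open>2|F|\<close> points,
  and Hall's theorem with the Schroeder--Bernstein argument yields a paradoxical decomposition.
\<close>

section \<open>Matchings and paradoxical decompositions\<close>

text \<open>Rado's argument: a minimal subrelation satisfying the marriage condition is the graph of a
  function. Minimal subrelations exist by Zorn's lemma, because all the image sets are finite.\<close>

lemma hall_matching:
  assumes fin: "\<And>i. i \<in> I \<Longrightarrow> finite (E `` {i})"
    and hall: "\<And>J. J \<subseteq> I \<Longrightarrow> finite J \<Longrightarrow> card J \<le> card (E `` J)"
  obtains f where "inj_on f I" "\<And>i. i \<in> I \<Longrightarrow> (i, f i) \<in> E"
proof -
  define H where "H T \<longleftrightarrow> (\<forall>J\<subseteq>I. finite J \<longrightarrow> card J \<le> card (T `` J))" for T :: "('a \<times> 'b) set"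
  have finE: "finite (T `` J)" if "T \<subseteq> E" "J \<subseteq> I" "finite J" for T J
  proof (rule finite_subset)
    show "T `` J \<subseteq> (\<Union>i\<in>J. E `` {i})" using that by auto
    show "finite (\<Union>i\<in>J. E `` {i})" using that fin by auto
  qed
  \<comment> \<open>Zorn's lemma is applied to the sets \<open>D\<close> of deleted edges: a maximal
    deletion leaves a minimal relation \<open>E - D\<close>.\<close>
  have "\<exists>M\<in>{D. D \<subseteq> E \<and> H (E - D)}. \<forall>X\<in>{D. D \<subseteq> E \<and> H (E - D)}. M \<subseteq> X \<longrightarrow> X = M"
  proof (rule subset_Zorn_nonempty)
    show "{D. D \<subseteq> E \<and> H (E - D)} \<noteq> {}" using hall by (auto simp: H_def)
    fix C assume C: "C \<noteq> {}" "subset.chain {D. D \<subseteq> E \<and> H (E - D)} C"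
    have "card J \<le> card ((E - \<Union>C) `` J)" if J: "J \<subseteq> I" "finite J" for J
    proof -
      \<comment> \<open>Only finitely many edges start in \<open>J\<close>, so those deleted by the
        union of the chain are already deleted by a single member \<open>D\<close>. Over
        \<open>J\<close> the two deletions therefore agree, and Hall's condition passes to the
        union.\<close>
      have "finite (\<Union>C \<inter> E \<inter> J \<times> UNIV)"
      proof (rule finite_subset)
        show "\<Union>C \<inter> E \<inter> J \<times> UNIV \<subseteq> J \<times> (E `` J)" by auto
        show "finite (J \<times> (E `` J))" using finE J by auto
      qed
      then obtain D where D: "D \<in> C" "\<Union>C \<inter> E \<inter> J \<times> UNIV \<subseteq> D"
        using finite_subset_Union_chain[OF _ _ C, of "\<Union>C \<inter> E \<inter> J \<times> UNIV"] by blast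
      then have "(E - \<Union>C) `` J = (E - D) `` J" by auto
      moreover have "H (E - D)" using D(1) C(2) by (auto simp: subset.chain_def)
      ultimately show ?thesis using J by (simp add: H_def)
    qed
    then show "\<Union>C \<in> {D. D \<subseteq> E \<and> H (E - D)}"
      using C(2) by (auto simp: H_def subset.chain_def)
  qed
  then obtain D where "D \<in> {D. D \<subseteq> E \<and> H (E - D)}"
    "\<forall>X\<in>{D. D \<subseteq> E \<and> H (E - D)}. D \<subseteq> X \<longrightarrow> X = D"
    by (rule bexE)
  then have D: "D \<subseteq> E" "H (E - D)"
    and max: "X \<subseteq> E \<Longrightarrow> H (E - X) \<Longrightarrow> D \<subseteq> X \<Longrightarrow> X = D" for X
    by simp_all
  define T where "T = E - D"
  have T: "T \<subseteq> E" "\<And>J. J \<subseteq> I \<Longrightarrow> finite J \<Longrightarrow> card J \<le> card (T `` J)"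
    using D by (auto simp: T_def H_def)
  \<comment> \<open>By maximality of \<open>D\<close>, deleting one more edge violates Hall's
    condition on some \<open>J\<close>. This \<open>J\<close> contains \<open>i\<close>, since
    otherwise its image would not have changed.\<close>
  have deficient: "\<exists>J\<subseteq>I. finite J \<and> i \<in> J \<and> card ((T - {(i, x)}) `` J) < card J" if "(i, x) \<in> T" for i x
  proof -
    have "\<not> H (E - insert (i, x) D)"
      using max[of "insert (i, x) D"] that D by (auto simp: T_def)
    moreover have "E - insert (i, x) D = T - {(i, x)}" by (auto simp: T_def)
    ultimately obtain J where J: "J \<subseteq> I" "finite J" "card ((T - {(i, x)}) `` J) < card J"
      by (auto simp: H_def not_le)
    moreover have "i \<in> J"
    proof (rule ccontr)
      assume "i \<notin> J"
      then have "(T - {(i, x)}) `` J = T `` J" by auto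
      then show False using J T(2)[of J] by simp
    qed
    ultimately show ?thesis by blast
  qed
  have single: "x = y" if x: "(i, x) \<in> T" and y: "(i, y) \<in> T" for i x y
  proof (rule ccontr)
    assume "x \<noteq> y"
    obtain J where J: "J \<subseteq> I" "finite J" "i \<in> J" "card ((T - {(i, x)}) `` J) < card J"
      using deficient[OF x] by blast
    obtain K where K: "K \<subseteq> I" "finite K" "i \<in> K" "card ((T - {(i, y)}) `` K) < card K"
      using deficient[OF y] by blast
    \<comment> \<open>Submodularity of cardinality gives the contradiction. Each of the two deleted
      edges survives in the other relation because \<open>x\<close> and \<open>y\<close> differ, so
      \<open>A \<union> B\<close> contains the image of \<open>J \<union> K\<close>; and
      \<open>A \<inter> B\<close> contains the image of \<open>J \<inter> K - {i}\<close>, which no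
      deletion touches. Hence |A| + |B| is at least |J| + |K| - 1, whereas deficiency allows at most
      |J| + |K| - 2.\<close>
    define A where "A = (T - {(i, x)}) `` J"
    define B where "B = (T - {(i, y)}) `` K"
    have fin': "finite A" "finite B"
      unfolding A_def B_def using finE[of "T - _"] J K T(1) by blast+
    have "T `` (J \<union> K) \<subseteq> A \<union> B" 
    proof
      fix v assume "v \<in> T `` (J \<union> K)"
      then obtain j where "j \<in> J \<union> K" "(j, v) \<in> T" by blast
      then show "v \<in> A \<union> B"
        using \<open>x \<noteq> y\<close> x y J(3) K(3) unfolding A_def B_def by blast
    qed
    then have "card (J \<union> K) \<le> card (A \<union> B)"
      using order_trans[OF T(2)[of "J \<union> K"] card_mono] J K fin' by simp
    moreover have "card (J \<inter> K - {i}) \<le> card (A \<inter> B)"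
    proof -
      have "T `` (J \<inter> K - {i}) \<subseteq> A \<inter> B" by (auto simp: A_def B_def)
      then show ?thesis
        using order_trans[OF T(2)[of "J \<inter> K - {i}"] card_mono] J K fin' by blast
    qed
    moreover have "Suc (card (J \<inter> K - {i})) = card (J \<inter> K)"
      using J(2,3) K(3) by (intro card_Suc_Diff1) auto
    moreover note card_Un_Int[OF fin'] card_Un_Int[OF J(2) K(2)] J(4) K(4)
    ultimately show False unfolding A_def[symmetric] B_def[symmetric] by linarith
  qed
  have ex: "\<exists>x. (i, x) \<in> T" if "i \<in> I" for i
    using T(2)[of "{i}"] that by (cases "T `` {i} = {}") auto
  then obtain f where f: "\<And>i. i \<in> I \<Longrightarrow> (i, f i) \<in> T" by metis
  have "inj_on f I"
  proof (rule inj_onI, rule ccontr)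
    fix i j assume ij: "i \<in> I" "j \<in> I" "f i = f j" "i \<noteq> j"
    \<comment> \<open>\<open>T\<close> is single-valued, so a collision would give two indices a
      one-point image, against Hall's condition.\<close>
    have "T `` {i, j} \<subseteq> {f i}"
    proof
      fix v assume "v \<in> T `` {i, j}"
      then consider "(i, v) \<in> T" | "(j, v) \<in> T" by blast
      then have "v = f i \<or> v = f j" using single f[OF ij(1)] f[OF ij(2)] by cases blast+
      then show "v \<in> {f i}" using ij(3) by simp
    qed
    then have "card (T `` {i, j}) \<le> card {f i}" by (intro card_mono) simp_all
    moreover have "card {i, j} \<le> card (T `` {i, j})" using ij by (intro T(2)) simp_all
    ultimately show False using ij(4) by simp
  qed
  moreover have "(i, f i) \<in> E" if "i \<in> I" for i using f[OF that] T(1) by (rule rev_subsetD)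
  ultimately show thesis by (rule that)
qed

text \<open>The map \<open>f\<close> packs two disjoint copies of \<open>A\<close> into
  \<open>A\<close>, possibly without filling it. Schroeder-Bernstein against the embedding of
  \<open>A\<close> as the layer \<open>True\<close> produces a bijection \<open>h\<close> from both
  copies onto \<open>A\<close>. Each value of \<open>h\<close> is either a value of \<open>f\<close>
  or the base point itself, so displacements stay bounded and the images of the two layers are the
  two pieces.\<close>

lemma paradoxicalI:
  fixes A :: "'a::metric_space set" and f :: "'a \<times> bool \<Rightarrow> 'a"
  assumes inj: "inj_on f (A \<times> UNIV)"
    and mem: "\<And>u. u \<in> A \<times> UNIV \<Longrightarrow> f u \<in> A"
    and dist: "\<And>u. u \<in> A \<times> UNIV \<Longrightarrow> dist (fst u) (f u) \<le> R"
  shows "paradoxical A"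
proof -
  define U where "U = A \<times> (UNIV :: bool set)"
  \<comment> \<open>Banach's decomposition for \<open>f\<close> and \<open>\<lambda>a. (a, True)\<close>\<close>
  define D where "D = lfp (\<lambda>D. U - (A - f ` D) \<times> {True})"
  have "mono (\<lambda>D. U - (A - f ` D) \<times> {True})" by (auto simp: mono_def)
  then have D: "D = U - (A - f ` D) \<times> {True}" unfolding D_def by (rule lfp_unfold)
  define h where "h u = (if u \<in> D then f u else fst u)" for u
  have DU: "D \<subseteq> U" using D by blast
  \<comment> \<open>Outside \<open>D\<close> only the layer \<open>True\<close> occurs, so
    \<open>fst\<close> is injective there, and its values avoid the image of \<open>D\<close> under
    \<open>f\<close>.\<close>
  have compl: "u \<in> (A - f ` D) \<times> {True}" if "u \<in> U" "u \<notin> D" for u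
    using D that by blast
  have "inj_on h U"
  proof (rule inj_onI)
    fix u v assume uv: "u \<in> U" "v \<in> U" "h u = h v"
    show "u = v"
    proof (cases "u \<in> D"; cases "v \<in> D")
      assume "u \<in> D" "v \<in> D"
      then show ?thesis using uv inj by (auto simp: h_def U_def dest: inj_onD)
    next
      assume "u \<in> D" "v \<notin> D"
      then show ?thesis using uv compl[of v] by (auto simp: h_def)
    next
      assume "u \<notin> D" "v \<in> D"
      then show ?thesis using uv compl[of u] by (force simp: h_def)
    next
      assume "u \<notin> D" "v \<notin> D"
      then show ?thesis using uv compl[of u] compl[of v] by (auto simp: h_def)
    qed
  qed
  moreover have "h ` U = A"
  proof (intro equalityI subsetI)
    fix a assume a: "a \<in> A"
    show "a \<in> h ` U"
    proof (cases "a \<in> f ` D")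
      case True
      then show ?thesis using DU by (force simp: h_def)
    next
      case False
      then have "(a, True) \<in> U" "(a, True) \<notin> D" using a D by (auto simp: U_def)
      then show ?thesis by (force simp: h_def)
    qed
  qed (use mem in \<open>auto simp: h_def U_def\<close>)
  ultimately have h: "inj_on h U" "h ` U = A" by auto
  \<comment> \<open>The 0 accounts for points outside \<open>D\<close>, which \<open>h\<close> does
    not move.\<close>
  have hdist: "dist a (h (a, b)) \<le> max R 0" if "a \<in> A" for a b
    using dist[of "(a, b)"] that by (auto simp: h_def)
  have pt: "partial_translation (\<lambda>a. h (a, b)) A (h ` (A \<times> {b}))" for b
    unfolding partial_translation_def
  proof
    show "bij_betw (\<lambda>a. h (a, b)) A (h ` (A \<times> {b}))"
      using h(1) by (auto simp: bij_betw_def inj_on_def U_def)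
    show "bdd_above ((\<lambda>a. dist a (h (a, b))) ` A)"
      using hdist by (intro bdd_aboveI2)
  qed
  have "A = h ` (A \<times> {True}) \<union> h ` (A \<times> {False})"
  proof -
    have "U = A \<times> {True} \<union> A \<times> {False}" by (auto simp: U_def)
    then show ?thesis using h(2) by (simp add: image_Un)
  qed
  moreover have "h ` (A \<times> {True}) \<inter> h ` (A \<times> {False}) = {}"
    by (subst inj_on_image_Int[OF h(1), symmetric]) (auto simp: U_def)
  ultimately show ?thesis 
    unfolding paradoxical_def using pt[of True] pt[of False] by (intro exI conjI)
qed

section \<open>Expansion of finite subsets in bounded geometry\<close>

lemma finite_cball:
  fixes x :: "'a::metric_space"
  assumes "bounded_geometry (UNIV :: 'a set)"
  shows "finite (cball x r)"
proof (rule finite_subset)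
  \<comment> \<open>\<open>bounded_geometry\<close> speaks of positive radii only, hence the
    enlargement to \<open>max r 1\<close>.\<close>
  show "cball x r \<subseteq> cball x (max r 1)" by auto
  have "0 < max r 1" by simp
  then show "finite (cball x (max r 1))"
    using assms unfolding bounded_geometry_def by (metis Int_UNIV_right UNIV_I)
qed

lemma paradoxicalI_doubling:
  fixes A :: "'a::metric_space set"
  assumes X: "bounded_geometry (UNIV :: 'a set)"
    and grow: "\<And>F. finite F \<Longrightarrow> F \<subseteq> A \<Longrightarrow> 2 * card F \<le> card (A \<inter> (\<Union>z\<in>F. cball z R))"
  shows "paradoxical A"
proof -
  define E where "E = {(u :: 'a \<times> bool, w). w \<in> A \<inter> cball (fst u) R}"
  obtain f where f: "inj_on f (A \<times> UNIV)" "\<And>u. u \<in> A \<times> UNIV \<Longrightarrow> (u, f u) \<in> E"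
  proof (rule hall_matching[of "A \<times> UNIV" E])
    show "finite (E `` {u})" for u
      by (rule finite_subset[OF _ finite_cball[OF X, of "fst u" R]]) (auto simp: E_def)
    fix J :: "('a \<times> bool) set" assume J: "J \<subseteq> A \<times> UNIV" "finite J"
    have "J \<subseteq> fst ` J \<times> UNIV" by (intro subrelI) (auto intro: rev_image_eqI)
    then have "card J \<le> card (fst ` J \<times> (UNIV :: bool set))"
      using J by (intro card_mono) auto
    also have "\<dots> = 2 * card (fst ` J)" by (simp add: card_cartesian_product)
    also have "\<dots> \<le> card (A \<inter> (\<Union>z\<in>fst ` J. cball z R))" using J by (intro grow) auto
    also have "A \<inter> (\<Union>z\<in>fst ` J. cball z R) = E `` J" by (force simp: E_def)
    finally show "card J \<le> card (E `` J)" .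
  qed (rule that)
  show ?thesis
    by (rule paradoxicalI[OF f(1), of R]) (use f(2) in \<open>auto simp: E_def\<close>)
qed

text \<open>An expansion factor \<open>3/2\<close> suffices, since \<open>(3/2)\<^sup>2 \<ge> 2\<close>.\<close>

lemma paradoxicalI_expansion:
  fixes A :: "'a::metric_space set"
  assumes X: "bounded_geometry (UNIV :: 'a set)"
    and grow: "\<And>F. finite F \<Longrightarrow> F \<subseteq> A \<Longrightarrow> 3 * card F \<le> 2 * card (A \<inter> (\<Union>z\<in>F. cball z R))"
  shows "paradoxical A"
proof (rule paradoxicalI_doubling[OF X, where R = "2 * R"])
  fix F assume F: "finite F" "F \<subseteq> A"
  define G where "G = A \<inter> (\<Union>z\<in>F. cball z R)"
  have "finite G" using F finite_cball[OF X] by (auto simp: G_def)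
  then have "3 * card G \<le> 2 * card (A \<inter> (\<Union>z\<in>G. cball z R))"
    by (intro grow) (auto simp: G_def)
  also have "card (A \<inter> (\<Union>z\<in>G. cball z R)) \<le> card (A \<inter> (\<Union>z\<in>F. cball z (2 * R)))"
  proof (rule card_mono)
    show "finite (A \<inter> (\<Union>z\<in>F. cball z (2 * R)))" using F finite_cball[OF X] by auto
    have "dist z v \<le> 2 * R" if "dist z w \<le> R" "dist w v \<le> R" for z w v :: 'a
      using that dist_triangle[of z v w] by simp
    then show "A \<inter> (\<Union>z\<in>G. cball z R) \<subseteq> A \<inter> (\<Union>z\<in>F. cball z (2 * R))"
      by (fastforce simp: G_def)
  qed
  finally show "2 * card F \<le> card (A \<inter> (\<Union>z\<in>F. cball z (2 * R)))"
    using grow[OF F] unfolding G_def by linarith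
qed

section \<open>Complex-linear operators\<close>

lemma cinner_commute: "cinner g f = cnj (cinner f g)"
  unfolding cinner_def infsum_cnj[symmetric] by (simp add: mult.commute)

lemma ell2_fun_basis: "ell2_fun (basis_ell2 y) x = (if x = y then 1 else 0)"
  by (simp add: basis_ell2.rep_eq)

lemma norm_basis_ell2: "norm (basis_ell2 y) = 1"
proof -
  have "(\<Sum>\<^sub>\<infinity>x. (cmod (ell2_fun (basis_ell2 y) x))\<^sup>2) = 1"
    by (rule infsumI, rule has_sum_finite_neutralI[of "{y}"]) (auto simp: ell2_fun_basis)
  then show ?thesis by (simp add: norm_ell2_def)
qed

lemma scaleC_simps:
  "scaleC c (f + g) = scaleC c f + scaleC c g"
  "scaleC c (f - g) = scaleC c f - scaleC c g"
  "scaleC c (- f) = - scaleC c f"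
  "scaleC c 0 = 0"
  by (rule ell2_eqI; simp add: scaleC.rep_eq plus_ell2.rep_eq minus_ell2.rep_eq
      uminus_ell2.rep_eq zero_ell2.rep_eq algebra_simps)+

lemma clinear_op_arith:
  "clinear_op 0"
  "clinear_op id_blinfun"
  "clinear_op S \<Longrightarrow> clinear_op T \<Longrightarrow> clinear_op (S + T)"
  "clinear_op S \<Longrightarrow> clinear_op T \<Longrightarrow> clinear_op (S - T)"
  "clinear_op T \<Longrightarrow> clinear_op (- T)"
  "clinear_op S \<Longrightarrow> clinear_op T \<Longrightarrow> clinear_op (S o\<^sub>L T)"
  by (simp_all add: clinear_op_def scaleC_simps blinfun.add_left blinfun.diff_left
      blinfun.minus_left)

lemma adj_eqI:
  assumes "\<And>f g. cinner (blinfun_apply T f) g = cinner f (blinfun_apply S g)"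
  shows "adj T = S"
  unfolding adj_def
proof (rule the_equality)
  fix S' assume "\<forall>f g. cinner (T f) g = cinner f (blinfun_apply S' g)"
  then show "S' = S" using assms by (intro blinfun_eqI cinner_eqI) metis
qed (use assms in blast)

lemma clinear_op_adj:
  assumes "clinear_op T"
  shows "clinear_op (adj T)"
  unfolding clinear_op_def
  by (intro allI cinner_eqI) (simp add: adj_cinner[OF assms, symmetric] cinner_simps)

lemma adj_diff:
  assumes "clinear_op S" "clinear_op T"
  shows "adj (S - T) = adj S - adj T"
  by (rule adj_eqI)
    (simp add: blinfun.diff_left cinner_simps adj_cinner[OF assms(1)] adj_cinner[OF assms(2)])

lemma adj_0: "adj 0 = 0"
  by (rule adj_eqI) (simp add: cinner_simps)

text \<open>Together with \<open>adj_diff\<close> this makes the adjoint norm-continuous on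
  complex-linear operators, so that it commutes with the limits defining the algebra.\<close>

lemma norm_adj_le:
  assumes T: "clinear_op T"
  shows "norm (adj T) \<le> norm T"
proof (rule norm_blinfun_bound)
  fix g
  have "(norm (adj T g))\<^sup>2 = Re (cinner (T (adj T g)) g)"
    by (simp add: adj_cinner[OF T] Re_cinner power2_norm_eq_inner)
  also have "\<dots> \<le> norm (T (adj T g)) * norm g"
    by (simp add: Re_cinner norm_cauchy_schwarz)
  also have "\<dots> \<le> norm T * norm (adj T g) * norm g"
    by (intro mult_right_mono norm_blinfun) simp
  finally have "norm (adj T g) * norm (adj T g) \<le> norm (adj T g) * (norm T * norm g)"
    by (simp add: power2_eq_square mult_ac)
  then show "norm (adj T g) \<le> norm T * norm g"
    by (cases "norm (adj T g) = 0") (auto dest: mult_left_le_imp_le)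
qed simp

lemma ell2_fun_adj_basis:
  assumes "clinear_op T"
  shows "ell2_fun (adj T (basis_ell2 y)) x = cnj (ell2_fun (T (basis_ell2 x)) y)"
  by (metis assms adj_cinner cinner_basis cinner_commute)

text \<open>Row \<open>x\<close> is the conjugate of the square-summable vector
  \<open>adj T (basis_ell2 x)\<close>. The row sum is thus an inner product, which converges even
  when the row has infinite support.\<close>

lemma clinear_op_has_matrix_basis:
  assumes T: "clinear_op T"
  shows "has_matrix T (\<lambda>x y. ell2_fun (T (basis_ell2 y)) x)"
  unfolding has_matrix_def
proof (intro allI)
  fix f x
  have "ell2_fun (T f) x = cinner (adj T (basis_ell2 x)) f"
    by (metis T adj_cinner cinner_basis cinner_commute)
  then show "ell2_fun (T f) x = (\<Sum>\<^sub>\<infinity>y. ell2_fun (T (basis_ell2 y)) x * ell2_fun f y)"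
    by (simp add: cinner_def ell2_fun_adj_basis[OF T])
qed

lemma has_matrix_basis:
  assumes "has_matrix T a"
  shows "ell2_fun (T (basis_ell2 y)) x = a x y"
proof -
  have "(\<Sum>\<^sub>\<infinity>z. a x z * ell2_fun (basis_ell2 y) z) = a x y"
    by (rule infsumI, rule has_sum_finite_neutralI[of "{y}"]) (auto simp: ell2_fun_basis)
  then show ?thesis using assms by (simp add: has_matrix_def)
qed

lemma clinear_op_eqI:
  assumes "clinear_op S" "clinear_op T" "\<And>y. S (basis_ell2 y) = T (basis_ell2 y)"
  shows "S = T"
  using has_matrix_unique[OF clinear_op_has_matrix_basis[OF assms(1)]]
    clinear_op_has_matrix_basis[OF assms(2)] assms(3) by simp

text \<open>The bridge from operator identities to the counting of squared coefficients.\<close>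

lemma norm_sq_compose_adj:
  assumes "clinear_op T"
  shows "cinner f ((adj T o\<^sub>L T) f) = complex_of_real ((norm (T f))\<^sup>2)"
proof -
  have "cinner f ((adj T o\<^sub>L T) f) = cinner (T f) (T f)"
    by (simp add: adj_cinner[OF assms])
  moreover have "Im (cinner (T f) (T f)) = 0"
    using cinner_commute[of "T f" "T f"] by (metis cnj.simps(2) equal_neg_zero)
  ultimately show ?thesis
    by (simp add: complex_eq_iff Re_cinner power2_norm_eq_inner)
qed

lemma adj_adj:
  assumes "clinear_op T"
  shows "adj (adj T) = T"
  by (rule adj_eqI) (metis adj_cinner[OF assms] cinner_commute)

section \<open>The uniform Roe algebra as a star ring\<close>

text \<open>A form of the generating operators that refers to no separate matrix and keeps track of
  the propagation bound. The entry bound in \<open>roe_matrix\<close> comes from the operator norm,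
  as \<open>roe_matrix_operator_iff\<close> shows.\<close>

definition finite_propagation :: "real \<Rightarrow> ('a::metric_space ell2 \<Rightarrow>\<^sub>L 'a ell2) \<Rightarrow> bool" where
  "finite_propagation r T \<longleftrightarrow> clinear_op T \<and>
     (\<forall>x y. ell2_fun (T (basis_ell2 y)) x \<noteq> 0 \<longrightarrow> dist x y \<le> r)"

lemma norm_ell2_fun_le: "cmod (ell2_fun f x) \<le> norm f"
  using cinner_Cauchy_Schwarz[of "basis_ell2 x" f] by (simp add: cinner_basis norm_basis_ell2)

lemma roe_matrix_operator_iff:
  "(\<exists>a. roe_matrix a \<and> has_matrix T a) \<longleftrightarrow> (\<exists>r. finite_propagation r T)"
proof
  assume "\<exists>a. roe_matrix a \<and> has_matrix T a"
  then obtain a where a: "roe_matrix a" "has_matrix T a" by blast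
  from a(1) obtain r where r: "\<And>t. t \<in> {dist x y | x y. a x y \<noteq> 0} \<Longrightarrow> t \<le> r"
    unfolding roe_matrix_def bdd_above_def by blast
  have "dist x y \<le> r" if "a x y \<noteq> 0" for x y
    using that by (intro r) blast
  then show "\<exists>r. finite_propagation r T"
    using clinear_op_has_matrix[OF a(2)] has_matrix_basis[OF a(2)]
    by (auto simp: finite_propagation_def)
next
  assume "\<exists>r. finite_propagation r T"
  then obtain r where T: "clinear_op T"
    and r: "\<And>x y. ell2_fun (T (basis_ell2 y)) x \<noteq> 0 \<Longrightarrow> dist x y \<le> r"
    by (auto simp: finite_propagation_def)
  have "cmod (ell2_fun (T (basis_ell2 y)) x) \<le> norm T" for x y
    using norm_ell2_fun_le[of "T (basis_ell2 y)" x] norm_blinfun[of T "basis_ell2 y"]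
    by (simp add: norm_basis_ell2)
  then have "roe_matrix (\<lambda>x y. ell2_fun (T (basis_ell2 y)) x)"
    unfolding roe_matrix_def by (intro conjI bdd_aboveI[of _ "norm T"] bdd_aboveI[of _ r]) (auto dest: r)
  then show "\<exists>a. roe_matrix a \<and> has_matrix T a"
    using clinear_op_has_matrix_basis[OF T] by blast
qed

lemma carrier_uniform_roe_algebra:
  "carrier uniform_roe_algebra = closure {T. \<exists>r. finite_propagation r T}"
  by (simp add: uniform_roe_algebra_def roe_matrix_operator_iff)

lemma uniform_roe_algebra_simps [simp]:
  "S \<otimes>\<^bsub>uniform_roe_algebra\<^esub> T = S o\<^sub>L T"
  "S \<oplus>\<^bsub>uniform_roe_algebra\<^esub> T = S + T"
  "\<one>\<^bsub>uniform_roe_algebra\<^esub> = id_blinfun"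
  "\<zero>\<^bsub>uniform_roe_algebra\<^esub> = 0"
  "star uniform_roe_algebra = adj"
  by (simp_all add: uniform_roe_algebra_def)

lemma finite_propagation_add:
  assumes "finite_propagation r S" "finite_propagation s T"
  shows "finite_propagation (max r s) (S + T)"
  using assms unfolding finite_propagation_def
  by (auto simp: clinear_op_arith blinfun.add_left plus_ell2.rep_eq)
    (metis add.right_neutral add_0 max.coboundedI1 max.coboundedI2)

lemma finite_propagation_uminus:
  "finite_propagation r T \<Longrightarrow> finite_propagation r (- T)"
  by (simp add: finite_propagation_def clinear_op_arith blinfun.minus_left uminus_ell2.rep_eq)

lemma finite_propagation_compose:
  assumes S: "finite_propagation r S" and T: "finite_propagation s T"
  shows "finite_propagation (r + s) (S o\<^sub>L T)"
  unfolding finite_propagation_def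
proof (intro conjI allI impI)
  have lin: "clinear_op S" "clinear_op T" using S T by (auto simp: finite_propagation_def)
  then show "clinear_op (S o\<^sub>L T)" by (rule clinear_op_arith)
  fix x y assume nz: "ell2_fun ((S o\<^sub>L T) (basis_ell2 y)) x \<noteq> 0"
  have "ell2_fun ((S o\<^sub>L T) (basis_ell2 y)) x =
      (\<Sum>\<^sub>\<infinity>z. ell2_fun (S (basis_ell2 z)) x * ell2_fun (T (basis_ell2 y)) z)"
    unfolding blinfun_apply_blinfun_compose
    by (rule clinear_op_has_matrix_basis[OF lin(1), unfolded has_matrix_def, rule_format])
  then have "\<exists>z. ell2_fun (S (basis_ell2 z)) x * ell2_fun (T (basis_ell2 y)) z \<noteq> 0"
    using nz infsum_0[of UNIV "\<lambda>z. ell2_fun (S (basis_ell2 z)) x * ell2_fun (T (basis_ell2 y)) z"]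
    by fastforce
  then obtain z where "ell2_fun (S (basis_ell2 z)) x * ell2_fun (T (basis_ell2 y)) z \<noteq> 0" ..
  then have "dist x z \<le> r" "dist z y \<le> s" using S T by (auto simp: finite_propagation_def)
  then show "dist x y \<le> r + s" using dist_triangle[of x y z] by simp
qed

lemma finite_propagation_adj:
  "finite_propagation r T \<Longrightarrow> finite_propagation r (adj T)"
  unfolding finite_propagation_def by (simp add: clinear_op_adj ell2_fun_adj_basis) (metis dist_commute)

lemma finite_propagation_in_uniform_roe_algebra:
  "finite_propagation r T \<Longrightarrow> T \<in> carrier uniform_roe_algebra"
  unfolding carrier_uniform_roe_algebra by (rule subsetD[OF closure_subset]) blast

text \<open>Each operation preserves finite propagation and is norm-continuous, so it passes to
  limits of sequences of finite propagation operators.\<close>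

lemma uniform_roe_algebra_closed:
  fixes S T :: "'a::metric_space ell2 \<Rightarrow>\<^sub>L 'a ell2"
  shows "S \<in> carrier uniform_roe_algebra \<Longrightarrow> T \<in> carrier uniform_roe_algebra \<Longrightarrow>
      S + T \<in> carrier uniform_roe_algebra"
    and "T \<in> carrier uniform_roe_algebra \<Longrightarrow> - T \<in> carrier uniform_roe_algebra"
    and "S \<in> carrier uniform_roe_algebra \<Longrightarrow> T \<in> carrier uniform_roe_algebra \<Longrightarrow>
      S o\<^sub>L T \<in> carrier uniform_roe_algebra"
    and "T \<in> carrier uniform_roe_algebra \<Longrightarrow> adj T \<in> carrier uniform_roe_algebra"
proof -
  have iff: "Z \<in> carrier uniform_roe_algebra \<longleftrightarrow> (\<exists>X. (\<forall>n. \<exists>r. finite_propagation r (X n)) \<and> X \<longlonglongrightarrow> Z)"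
    for Z :: "'a ell2 \<Rightarrow>\<^sub>L 'a ell2"
    unfolding carrier_uniform_roe_algebra closure_sequential by simp
  have lim: "Z \<in> carrier uniform_roe_algebra"
    if "\<And>n. \<exists>r. finite_propagation r (X n)" "X \<longlonglongrightarrow> Z" for Z and X :: "nat \<Rightarrow> 'a ell2 \<Rightarrow>\<^sub>L 'a ell2"
    using that unfolding iff by blast
  {
    assume T: "T \<in> carrier uniform_roe_algebra"
    then obtain Y where Y: "\<And>n. \<exists>r. finite_propagation r (Y n)" "Y \<longlonglongrightarrow> T"
      unfolding iff by blast
    show "- T \<in> carrier uniform_roe_algebra"
      using Y(1) finite_propagation_uminus by (intro lim[OF _ tendsto_minus[OF Y(2)]]) blast
    have "(\<lambda>n. adj (Y n)) \<longlonglongrightarrow> adj T"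
    proof (rule metric_tendsto_imp_tendsto[OF Y(2)], rule always_eventually, rule allI)
      fix n
      have "clinear_op (Y n)" "clinear_op T"
        using Y(1) uniform_roe_algebra_clinear_op[OF T] by (auto simp: finite_propagation_def)
      then show "dist (adj (Y n)) (adj T) \<le> dist (Y n) T"
        unfolding dist_norm by (simp add: adj_diff[symmetric] norm_adj_le clinear_op_arith)
    qed
    then show "adj T \<in> carrier uniform_roe_algebra"
      using Y(1) finite_propagation_adj by (intro lim[of "\<lambda>n. adj (Y n)"]) blast+
    assume "S \<in> carrier uniform_roe_algebra"
    then obtain X where X: "\<And>n. \<exists>r. finite_propagation r (X n)" "X \<longlonglongrightarrow> S"
      unfolding iff by blast
    show "S + T \<in> carrier uniform_roe_algebra"
      using X(1) Y(1) finite_propagation_add by (intro lim[OF _ tendsto_add[OF X(2) Y(2)]]) blast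
    show "S o\<^sub>L T \<in> carrier uniform_roe_algebra"
      using X(1) Y(1) finite_propagation_compose
      by (intro lim[OF _ bounded_bilinear.tendsto[OF bounded_bilinear_blinfun_compose X(2) Y(2)]]) blast
  }
qed

lemma uniform_roe_algebra_zero: "0 \<in> carrier uniform_roe_algebra"
  by (rule finite_propagation_in_uniform_roe_algebra[of 0])
    (simp add: finite_propagation_def clinear_op_arith zero_ell2.rep_eq)

lemma ring_uniform_roe_algebra:
  "ring (uniform_roe_algebra :: ('a::metric_space ell2 \<Rightarrow>\<^sub>L 'a ell2) star_ring)"
proof (rule ringI)
  show "abelian_group (uniform_roe_algebra :: ('a ell2 \<Rightarrow>\<^sub>L 'a ell2) star_ring)"
  proof (rule abelian_groupI)
    fix T :: "'a ell2 \<Rightarrow>\<^sub>L 'a ell2" assume "T \<in> carrier uniform_roe_algebra"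
    then have "- T \<in> carrier uniform_roe_algebra" by (intro uniform_roe_algebra_closed)
    then show "\<exists>S\<in>carrier uniform_roe_algebra.
        S \<oplus>\<^bsub>uniform_roe_algebra\<^esub> T = \<zero>\<^bsub>uniform_roe_algebra\<^esub>"
      by (intro bexI[of _ "- T"]) simp_all
  qed (simp_all add: uniform_roe_algebra_closed uniform_roe_algebra_zero add_ac)
  have "finite_propagation 0 (id_blinfun :: 'a ell2 \<Rightarrow>\<^sub>L 'a ell2)"
    by (simp add: finite_propagation_def clinear_op_arith ell2_fun_basis)
  from finite_propagation_in_uniform_roe_algebra[OF this]
  show "Group.monoid (uniform_roe_algebra :: ('a ell2 \<Rightarrow>\<^sub>L 'a ell2) star_ring)"
    by (intro monoidI) (simp_all add: uniform_roe_algebra_closed blinfun_eqI)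
qed (simp_all add: blinfun_eqI blinfun.add_left blinfun.add_right)

text \<open>Matrix products are defined with \<open>finsum\<close>, whereas inner products are
  computed with ordinary sums of operators.\<close>

lemma finsum_uniform_roe_algebra:
  fixes f :: "'i \<Rightarrow> 'a::metric_space ell2 \<Rightarrow>\<^sub>L 'a ell2"
  assumes "finite I" "\<And>i. i \<in> I \<Longrightarrow> f i \<in> carrier uniform_roe_algebra"
  shows "finsum uniform_roe_algebra f I = sum f I"
proof -
  interpret ring "uniform_roe_algebra :: ('a ell2 \<Rightarrow>\<^sub>L 'a ell2) star_ring"
    by (rule ring_uniform_roe_algebra)
  show ?thesis using assms by (induction I rule: finite_induct) (simp_all add: Pi_def)
qed

section \<open>Diagonal projections and the partial isometries of partial translations\<close>

lemma char_proj_basis: "char_proj A (basis_ell2 z) = (if z \<in> A then basis_ell2 z else 0)"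
  by (rule ell2_eqI) (simp add: char_proj.rep_eq ell2_restrict.rep_eq ell2_fun_basis zero_ell2.rep_eq)

lemma clinear_op_char_proj: "clinear_op (char_proj A)"
  by (rule clinear_op_has_matrix[OF has_matrix_char_proj])

lemma finite_propagation_char_proj: "finite_propagation 0 (char_proj A)"
  using clinear_op_char_proj
  by (simp add: finite_propagation_def char_proj_basis ell2_fun_basis zero_ell2.rep_eq)

lemma is_projection_char_proj: "is_projection uniform_roe_algebra (char_proj A)"
proof -
  note lin = clinear_op_char_proj[of A]
  have "adj (char_proj A) = char_proj A"
    by (rule clinear_op_eqI[OF clinear_op_adj[OF lin] lin], rule ell2_eqI)
      (simp add: ell2_fun_adj_basis[OF lin] char_proj_basis ell2_fun_basis zero_ell2.rep_eq)
  moreover have "char_proj A o\<^sub>L char_proj A = char_proj A"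
    by (rule clinear_op_eqI) (simp_all add: clinear_op_arith lin char_proj_basis)
  ultimately show ?thesis
    using finite_propagation_in_uniform_roe_algebra[OF finite_propagation_char_proj]
    by (simp add: is_projection_def)
qed

text \<open>\<open>V\<close> sends the basis vector at \<open>z\<close> in \<open>A\<close> to the
  one at \<open>t z\<close> and kills the others. Its propagation is bounded by the displacement of
  \<open>t\<close>, and bounded geometry turns the 0-1 matrix into a bounded operator.\<close>

lemma partial_translation_operator:
  fixes A B :: "'a::metric_space set"
  assumes X: "bounded_geometry (UNIV :: 'a set)" and t: "partial_translation t A B"
  obtains V where "V \<in> carrier uniform_roe_algebra" "adj V o\<^sub>L V = char_proj A" "V o\<^sub>L adj V = char_proj B"
proof -
  define a :: "'a \<Rightarrow> 'a \<Rightarrow> complex" where "a w z = (if z \<in> A \<and> w = t z then 1 else 0)" for w z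
  from t have bij: "bij_betw t A B" by (simp add: partial_translation_def)
  from t obtain K where K: "\<And>z. z \<in> A \<Longrightarrow> dist z (t z) \<le> K"
    by (auto simp: partial_translation_def bdd_above_def)
  have "roe_matrix a"
    unfolding roe_matrix_def
    by (intro conjI bdd_aboveI[of _ 1] bdd_aboveI[of _ K])
      (auto simp: a_def dist_commute K split: if_splits)
  then obtain V where V: "has_matrix V a"
    using roe_matrix_has_operator[OF X] by blast
  have lin: "clinear_op V" "clinear_op (adj V)"
    using clinear_op_has_matrix[OF V] clinear_op_adj by blast+
  have Vb: "V (basis_ell2 z) = (if z \<in> A then basis_ell2 (t z) else 0)" for z
    by (rule ell2_eqI) (simp add: has_matrix_basis[OF V] a_def ell2_fun_basis zero_ell2.rep_eq)
  have Ab: "adj V (basis_ell2 (t z)) = basis_ell2 z" if "z \<in> A" for z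
    using bij that by (intro ell2_eqI)
      (auto simp: ell2_fun_adj_basis[OF lin(1)] has_matrix_basis[OF V] a_def ell2_fun_basis
        bij_betw_def dest: inj_onD)
  have A0: "adj V (basis_ell2 w) = 0" if "w \<notin> B" for w
    using bij that by (intro ell2_eqI)
      (auto simp: ell2_fun_adj_basis[OF lin(1)] has_matrix_basis[OF V] a_def zero_ell2.rep_eq bij_betw_def)
  show thesis
  proof (rule that)
    show "V \<in> carrier uniform_roe_algebra"
      using V \<open>roe_matrix a\<close> roe_matrix_operator_iff[of V] finite_propagation_in_uniform_roe_algebra
      by blast
    show "adj V o\<^sub>L V = char_proj A"
      by (rule clinear_op_eqI) (simp_all add: clinear_op_arith lin clinear_op_char_proj Vb Ab char_proj_basis)
    show "V o\<^sub>L adj V = char_proj B"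
    proof (rule clinear_op_eqI)
      fix w
      show "(V o\<^sub>L adj V) (basis_ell2 w) = char_proj B (basis_ell2 w)"
      proof (cases "w \<in> B")
        case True
        then obtain z where "z \<in> A" "w = t z" using bij by (auto simp: bij_betw_def)
        then show ?thesis using True by (simp add: Ab Vb char_proj_basis)
      qed (simp add: A0 char_proj_basis)
    qed (simp_all add: clinear_op_arith lin clinear_op_char_proj)
  qed
qed

lemma char_proj_add_disjoint:
  assumes "A \<inter> B = {}"
  shows "char_proj A + char_proj B = char_proj (A \<union> B)"
  by (rule blinfun_eqI, rule ell2_eqI)
    (use assms in \<open>auto simp: blinfun.add_left plus_ell2.rep_eq char_proj.rep_eq ell2_restrict.rep_eq indicator_def\<close>)

text \<open>The two partial isometries have range projections onto complementary pieces of
  \<open>A\<close>. These add up to \<open>char_proj A\<close>, so the required inequality is an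
  equality and its difference is witnessed by 0.\<close>

lemma paradoxical_imp_properly_infinite:
  fixes A :: "'a::metric_space set"
  assumes X: "bounded_geometry (UNIV :: 'a set)" and A: "paradoxical A"
  shows "properly_infinite uniform_roe_algebra (char_proj A)"
proof -
  obtain B C s t where BC: "A = B \<union> C" "B \<inter> C = {}"
    and st: "partial_translation s A B" "partial_translation t A C"
    using A unfolding paradoxical_def by blast
  have pi: "\<exists>V. partial_isometry uniform_roe_algebra V \<and> V \<in> carrier uniform_roe_algebra \<and>
      adj V o\<^sub>L V = char_proj A \<and> V o\<^sub>L adj V = char_proj D"
    if u: "partial_translation u A D" "D \<subseteq> A" for u D
  proof -
    obtain V where V: "V \<in> carrier uniform_roe_algebra" "adj V o\<^sub>L V = char_proj A" "V o\<^sub>L adj V = char_proj D"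
      using partial_translation_operator[OF X u(1)] .
    have lin: "clinear_op V" by (rule uniform_roe_algebra_clinear_op[OF V(1)])
    \<comment> \<open>This is the partial isometry law once \<open>adj V o\<^sub>L V\<close> is
      replaced by \<open>char_proj A\<close>. Off \<open>A\<close>, the squared norm of the image of
      a basis vector is a diagonal entry of \<open>char_proj A\<close>, hence 0.\<close>
    have "V o\<^sub>L char_proj A = V"
    proof (rule clinear_op_eqI)
      fix z
      show "(V o\<^sub>L char_proj A) (basis_ell2 z) = V (basis_ell2 z)"
      proof (cases "z \<in> A")
        case False
        then have "complex_of_real ((norm (V (basis_ell2 z)))\<^sup>2) = 0"
          unfolding norm_sq_compose_adj[OF lin, symmetric] V(2) by (simp add: char_proj_basis cinner_simps)
        then show ?thesis using False by (simp add: char_proj_basis)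
      qed (simp add: char_proj_basis)
    qed (simp_all add: clinear_op_arith lin clinear_op_char_proj)
    moreover have "V o\<^sub>L adj V o\<^sub>L V = V o\<^sub>L (adj V o\<^sub>L V)" by (rule blinfun_eqI) simp
    ultimately have "V o\<^sub>L adj V o\<^sub>L V = V" by (simp add: V(2))
    then show ?thesis using V by (auto simp: partial_isometry_def)
  qed
  obtain V where V: "partial_isometry uniform_roe_algebra V" "V \<in> carrier uniform_roe_algebra"
      "adj V o\<^sub>L V = char_proj A" "V o\<^sub>L adj V = char_proj B"
    using pi[OF st(1)] BC(1) by blast
  obtain W where W: "partial_isometry uniform_roe_algebra W" "W \<in> carrier uniform_roe_algebra"
      "adj W o\<^sub>L W = char_proj A" "W o\<^sub>L adj W = char_proj C"
    using pi[OF st(2)] BC(1) by blast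
  have carr: "char_proj A \<in> carrier uniform_roe_algebra"
    using is_projection_char_proj[of A] by (simp add: is_projection_def)
  interpret ring "uniform_roe_algebra :: ('a ell2 \<Rightarrow>\<^sub>L 'a ell2) star_ring"
    by (rule ring_uniform_roe_algebra)
  have "char_proj A \<ominus>\<^bsub>uniform_roe_algebra\<^esub> char_proj A = 0"
    using r_neg[OF carr] by (simp add: a_minus_def)
  then have "star_le uniform_roe_algebra (char_proj A) (char_proj A)"
    using carr uniform_roe_algebra_zero by (auto simp: star_le_def adj_0 intro!: bexI[of _ 0])
  then have "star_le uniform_roe_algebra ((V o\<^sub>L adj V) + (W o\<^sub>L adj W)) (char_proj A)"
    using BC by (simp add: V(4) W(4) char_proj_add_disjoint)
  then show ?thesis
    unfolding properly_infinite_def using is_projection_char_proj[of A] V W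
    by - (rule conjI, assumption, rule exI[of _ V], rule exI[of _ W], simp)
qed

section \<open>Truncation to finite propagation\<close>

lemma norm_sq_split_finite:
  assumes "finite B"
  shows "(norm f)\<^sup>2 = (\<Sum>w\<in>B. (cmod (ell2_fun f w))\<^sup>2) + (norm (ell2_restrict (- B) f))\<^sup>2"
proof -
  let ?s = "\<lambda>w. (cmod (ell2_fun f w))\<^sup>2"
  have h: "((\<lambda>w. if w \<in> B then ?s w else 0) has_sum sum ?s B) UNIV"
    by (rule has_sum_finite_neutralI[OF assms]) auto
  have "(\<Sum>\<^sub>\<infinity>w. ?s w) = (\<Sum>\<^sub>\<infinity>w. (if w \<in> B then ?s w else 0) + (cmod (ell2_fun (ell2_restrict (- B) f) w))\<^sup>2)"
    by (rule infsum_cong) (simp add: ell2_restrict.rep_eq)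
  also have "\<dots> = sum ?s B + (norm (ell2_restrict (- B) f))\<^sup>2"
    unfolding norm_ell2_sq
    by (subst infsum_add) (use ell2_summable h in \<open>auto simp: has_sum_iff\<close>)
  finally show ?thesis by (simp add: norm_ell2_sq)
qed

text \<open>Choose \<open>S\<close> of propagation \<open>R\<close> within \<open>sqrt e\<close> of
  \<open>T\<close>. Outside the ball of radius \<open>r\<close> at least \<open>R\<close> the column
  of \<open>S\<close> vanishes, so the tail of the column of \<open>T\<close> is a tail of
  \<open>T - S\<close>, of squared norm at most \<open>e\<close>. The radius is the same for all
  \<open>z\<close>; the form with \<open>at_top\<close> lets finitely many operators share one
  radius.\<close>

lemma uniform_roe_algebra_truncation:
  fixes T :: "'a::metric_space ell2 \<Rightarrow>\<^sub>L 'a ell2"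
  assumes X: "bounded_geometry (UNIV :: 'a set)"
    and T: "T \<in> carrier uniform_roe_algebra" and e: "0 < e"
  shows "\<forall>\<^sub>F r in at_top. \<forall>z. (norm (T (basis_ell2 z)))\<^sup>2 - e \<le>
    (\<Sum>w\<in>cball z r. (cmod (ell2_fun (T (basis_ell2 z)) w))\<^sup>2)"
proof -
  have "0 < sqrt e" using e by simp
  then obtain S R where S: "finite_propagation R S" "dist S T < sqrt e"
    using T unfolding carrier_uniform_roe_algebra closure_approachable by blast
  have "(norm (T (basis_ell2 z)))\<^sup>2 - e \<le> (\<Sum>w\<in>cball z r. (cmod (ell2_fun (T (basis_ell2 z)) w))\<^sup>2)"
    if r: "R \<le> r" for r z
  proof -
    let ?f = "T (basis_ell2 z)" and ?g = "S (basis_ell2 z)"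
    have "ell2_fun ?g w = 0" if "w \<notin> cball z r" for w
      using that r S(1) unfolding finite_propagation_def
      by (metis dist_commute mem_cball order_trans)
    then have "ell2_restrict (- cball z r) ?f = ell2_restrict (- cball z r) (?f - ?g)"
      by (intro ell2_eqI) (auto simp: ell2_restrict.rep_eq minus_ell2.rep_eq indicator_def)
    then have "norm (ell2_restrict (- cball z r) ?f) \<le> norm ((T - S) (basis_ell2 z))"
      by (simp add: norm_ell2_restrict_le blinfun.diff_left)
    also have "\<dots> \<le> norm (T - S)" using norm_blinfun[of "T - S" "basis_ell2 z"] by (simp add: norm_basis_ell2)
    also have "\<dots> \<le> sqrt e" using S(2) by (simp add: dist_norm norm_minus_commute)
    finally have "(norm (ell2_restrict (- cball z r) ?f))\<^sup>2 \<le> e"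
      using e by (metis norm_ge_zero power_mono real_sqrt_pow2 less_imp_le)
    then show ?thesis
      using norm_sq_split_finite[of "cball z r" ?f] finite_cball[OF X, of z r] by simp
  qed
  then show ?thesis unfolding eventually_at_top_linorder by blast
qed

text \<open>Row \<open>w\<close> of \<open>T\<close> is the conjugate of column \<open>w\<close> of
  the adjoint, so part of its mass is bounded by the whole squared norm.\<close>

lemma bessel_row:
  assumes "clinear_op T" "finite F"
  shows "(\<Sum>z\<in>F. (cmod (ell2_fun (T (basis_ell2 z)) w))\<^sup>2) \<le> (norm (adj T (basis_ell2 w)))\<^sup>2"
proof -
  have "(\<Sum>z\<in>F. (cmod (ell2_fun (adj T (basis_ell2 w)) z))\<^sup>2) \<le> (norm (adj T (basis_ell2 w)))\<^sup>2"
    unfolding norm_ell2_sq by (intro finite_sum_le_infsum ell2_summable assms) auto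
  then show ?thesis by (simp add: ell2_fun_adj_basis[OF assms(1)])
qed

section \<open>Matrices over a star ring\<close>

lemma mat_of_apply [simp]: "i < n \<Longrightarrow> j < n \<Longrightarrow> mat_of n m i j = m i j"
  by (simp add: mat_of_def)

lemma mat_of_cong: "(\<And>i j. i < n \<Longrightarrow> j < n \<Longrightarrow> f i j = g i j) \<Longrightarrow> mat_of n f = mat_of n g"
  unfolding mat_of_def by (intro restrict_ext) auto

lemma mat_of_eta:
  assumes "a \<in> {..<n} \<rightarrow>\<^sub>E {..<n} \<rightarrow>\<^sub>E C"
  shows "mat_of n a = a"
proof -
  have "mat_of n a = restrict a {..<n}"
    unfolding mat_of_def using assms by (intro restrict_ext PiE_restrict) (rule PiE_mem)
  then show ?thesis using PiE_restrict[OF assms] by simp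
qed

lemma mat_of_closed:
  "(\<And>i j. i < n \<Longrightarrow> j < n \<Longrightarrow> f i j \<in> C) \<Longrightarrow> mat_of n f \<in> {..<n} \<rightarrow>\<^sub>E {..<n} \<rightarrow>\<^sub>E C"
  by (auto simp: mat_of_def)

text \<open>Supplies the cancellation laws for the subtraction that occurs in
  \<open>star_le\<close>.\<close>

lemma abelian_group_mat_star_ring:
  assumes "abelian_group B"
  shows "abelian_group (mat_star_ring B n)"
proof -
  interpret abelian_group B by (rule assms)
  show ?thesis
  proof (rule abelian_groupI)
    fix x assume x: "x \<in> carrier (mat_star_ring B n)"
    then have mem: "x i j \<in> carrier B" if "i < n" "j < n" for i j
      using that by (auto simp: mat_star_ring_def)
    let ?y = "mat_of n (\<lambda>i j. \<ominus>\<^bsub>B\<^esub> x i j)"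
    have "?y \<in> carrier (mat_star_ring B n)"
      using mem by (auto simp: mat_star_ring_def intro!: mat_of_closed)
    moreover have "?y \<oplus>\<^bsub>mat_star_ring B n\<^esub> x = \<zero>\<^bsub>mat_star_ring B n\<^esub>"
      using mem by (auto simp: mat_star_ring_def l_neg intro!: mat_of_cong)
    ultimately show "\<exists>y\<in>carrier (mat_star_ring B n). y \<oplus>\<^bsub>mat_star_ring B n\<^esub> x = \<zero>\<^bsub>mat_star_ring B n\<^esub>"
      by blast
  next
    fix x y assume "x \<in> carrier (mat_star_ring B n)" "y \<in> carrier (mat_star_ring B n)"
    then have mem: "x i j \<in> carrier B" "y i j \<in> carrier B" if "i < n" "j < n" for i j
      using that by (auto simp: mat_star_ring_def)
    show "x \<oplus>\<^bsub>mat_star_ring B n\<^esub> y \<in> carrier (mat_star_ring B n)"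
      using mem by (auto simp: mat_star_ring_def intro!: mat_of_closed)
    show "x \<oplus>\<^bsub>mat_star_ring B n\<^esub> y = y \<oplus>\<^bsub>mat_star_ring B n\<^esub> x"
      using mem by (auto simp: mat_star_ring_def a_comm intro!: mat_of_cong)
    fix z assume "z \<in> carrier (mat_star_ring B n)"
    then have "z i j \<in> carrier B" if "i < n" "j < n" for i j
      using that by (auto simp: mat_star_ring_def)
    then show "x \<oplus>\<^bsub>mat_star_ring B n\<^esub> y \<oplus>\<^bsub>mat_star_ring B n\<^esub> z =
        x \<oplus>\<^bsub>mat_star_ring B n\<^esub> (y \<oplus>\<^bsub>mat_star_ring B n\<^esub> z)"
      using mem by (auto simp: mat_star_ring_def a_assoc intro!: mat_of_cong)
  next
    show "\<zero>\<^bsub>mat_star_ring B n\<^esub> \<in> carrier (mat_star_ring B n)"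
      by (auto simp: mat_star_ring_def intro!: mat_of_closed)
    fix x assume x: "x \<in> carrier (mat_star_ring B n)"
    then have "x i j \<in> carrier B" if "i < n" "j < n" for i j
      using that by (auto simp: mat_star_ring_def)
    then have "\<zero>\<^bsub>mat_star_ring B n\<^esub> \<oplus>\<^bsub>mat_star_ring B n\<^esub> x = mat_of n x"
      by (auto simp: mat_star_ring_def intro!: mat_of_cong)
    then show "\<zero>\<^bsub>mat_star_ring B n\<^esub> \<oplus>\<^bsub>mat_star_ring B n\<^esub> x = x"
      using x mat_of_eta by (auto simp: mat_star_ring_def)
  qed
qed

text \<open>What the diagonal embedding needs in order to respect the star operations;
  \<open>star_zero\<close> keeps off-diagonal entries zero under the involution.\<close>

locale star_closed_ring = ring B for B :: "('b, 'm) star_ring_scheme" (structure) +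
  assumes star_closed: "x \<in> carrier B \<Longrightarrow> star B x \<in> carrier B"
    and star_zero: "star B \<zero> = \<zero>"
begin

lemma mat_direct_sum_closed: "a \<in> carrier B \<Longrightarrow> mat_direct_sum B n a \<in> carrier (mat_star_ring B n)"
  by (auto simp: mat_direct_sum_def mat_star_ring_def intro!: mat_of_closed)

lemma mat_direct_sum_mult:
  assumes "a \<in> carrier B" "b \<in> carrier B"
  shows "mat_direct_sum B n a \<otimes>\<^bsub>mat_star_ring B n\<^esub> mat_direct_sum B n b = mat_direct_sum B n (a \<otimes> b)"
proof -
  have "(\<Oplus>k\<in>{..<n}. mat_direct_sum B n a i k \<otimes> mat_direct_sum B n b k j) =
      (if i = j then a \<otimes> b else \<zero>)" if ij: "i < n" "j < n" for i j
  proof -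
    have "(\<Oplus>k\<in>{..<n}. mat_direct_sum B n a i k \<otimes> mat_direct_sum B n b k j) =
        (\<Oplus>k\<in>{..<n}. if i = k then (if i = j then a \<otimes> b else \<zero>) else \<zero>)"
      using ij assms by (intro finsum_cong') (auto simp: mat_direct_sum_def)
    also have "\<dots> = (if i = j then a \<otimes> b else \<zero>)"
      using ij assms by (intro finsum_singleton) auto
    finally show ?thesis .
  qed
  then show ?thesis
    by (auto simp: mat_star_ring_def mat_direct_sum_def[of B n "a \<otimes> b"] intro!: mat_of_cong)
qed

lemma mat_direct_sum_add:
  "a \<in> carrier B \<Longrightarrow> b \<in> carrier B \<Longrightarrow>
    mat_direct_sum B n a \<oplus>\<^bsub>mat_star_ring B n\<^esub> mat_direct_sum B n b = mat_direct_sum B n (a \<oplus> b)"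
  by (auto simp: mat_star_ring_def mat_direct_sum_def intro!: mat_of_cong)

lemma mat_direct_sum_star: "star (mat_star_ring B n) (mat_direct_sum B n a) = mat_direct_sum B n (star B a)"
  by (auto simp: mat_star_ring_def mat_direct_sum_def star_zero intro!: mat_of_cong)

text \<open>Subtraction of matrices goes through the abstract additive inverse rather than entries,
  so the difference is identified by adding the subtrahend back.\<close>

lemma mat_direct_sum_minus:
  assumes a: "a \<in> carrier B" and b: "b \<in> carrier B"
  shows "mat_direct_sum B n a \<ominus>\<^bsub>mat_star_ring B n\<^esub> mat_direct_sum B n b = mat_direct_sum B n (a \<ominus> b)"
proof -
  interpret M: abelian_group "mat_star_ring B n"
    by (rule abelian_group_mat_star_ring) (rule abelian_group_axioms)
  have "mat_direct_sum B n (a \<ominus> b) \<oplus>\<^bsub>mat_star_ring B n\<^esub> mat_direct_sum B n b = mat_direct_sum B n a"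
    using a b by (simp add: mat_direct_sum_add a_minus_def a_assoc l_neg)
  then have "mat_direct_sum B n a \<ominus>\<^bsub>mat_star_ring B n\<^esub> mat_direct_sum B n b =
      (mat_direct_sum B n (a \<ominus> b) \<oplus>\<^bsub>mat_star_ring B n\<^esub> mat_direct_sum B n b)
        \<ominus>\<^bsub>mat_star_ring B n\<^esub> mat_direct_sum B n b"
    by simp
  also have "\<dots> = mat_direct_sum B n (a \<ominus> b)"
    using a b mat_direct_sum_closed[of "a \<ominus> b" n] mat_direct_sum_closed[OF b, of n]
    by (simp add: M.minus_eq M.a_assoc M.r_neg)
  finally show ?thesis .
qed

text \<open>The diagonal embedding respects every operation in the definition, so the witnesses
  \<open>x\<close>, \<open>y\<close> and the square root \<open>z\<close> of the difference can be
  embedded one by one.\<close>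

lemma properly_infinite_mat_direct_sum:
  assumes "properly_infinite B p"
  shows "properly_infinite (mat_star_ring B n) (mat_direct_sum B n p)"
proof -
  let ?d = "mat_direct_sum B n"
  from assms obtain x y z where p: "p \<in> carrier B" "star B p = p" "p \<otimes> p = p"
    and x: "x \<in> carrier B" "x \<otimes> star B x \<otimes> x = x" "star B x \<otimes> x = p"
    and y: "y \<in> carrier B" "y \<otimes> star B y \<otimes> y = y" "star B y \<otimes> y = p"
    and z: "z \<in> carrier B" "p \<ominus> (x \<otimes> star B x \<oplus> y \<otimes> star B y) = star B z \<otimes> z"
    unfolding properly_infinite_def is_projection_def partial_isometry_def star_le_def by blast
  note closed = p(1) x(1) y(1) z(1) star_closed
  note hom = mat_direct_sum_closed mat_direct_sum_mult mat_direct_sum_add mat_direct_sum_minus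
    mat_direct_sum_star
  have "is_projection (mat_star_ring B n) (?d p)"
    by (simp add: is_projection_def hom closed p)
  moreover have "partial_isometry (mat_star_ring B n) (?d w)"
    if "w \<in> carrier B" "w \<otimes> star B w \<otimes> w = w" for w
    using that by (simp add: partial_isometry_def hom closed)
  moreover have "star_le (mat_star_ring B n)
      (?d x \<otimes>\<^bsub>mat_star_ring B n\<^esub> star (mat_star_ring B n) (?d x) \<oplus>\<^bsub>mat_star_ring B n\<^esub>
       ?d y \<otimes>\<^bsub>mat_star_ring B n\<^esub> star (mat_star_ring B n) (?d y)) (?d p)"
    unfolding star_le_def by (intro conjI bexI[of _ "?d z"]) (simp_all add: hom closed z)
  moreover have "star (mat_star_ring B n) (?d x) \<otimes>\<^bsub>mat_star_ring B n\<^esub> ?d x = ?d p"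
    "star (mat_star_ring B n) (?d y) \<otimes>\<^bsub>mat_star_ring B n\<^esub> ?d y = ?d p"
    by (simp_all add: hom closed x y)
  ultimately show ?thesis
    unfolding properly_infinite_def using x y by blast
qed

end

section \<open>Properly infinite multiples of a diagonal projection\<close>

lemma star_closed_ring_uniform_roe_algebra: "star_closed_ring uniform_roe_algebra"
  by (intro star_closed_ring.intro star_closed_ring_axioms.intro ring_uniform_roe_algebra)
    (simp_all add: uniform_roe_algebra_closed adj_0)

section \<open>Entries of matrices over the uniform Roe algebra\<close>

abbreviation mat_roe :: "nat \<Rightarrow> (nat \<Rightarrow> nat \<Rightarrow> 'a::metric_space ell2 \<Rightarrow>\<^sub>L 'a ell2) star_ring" where
  "mat_roe \<equiv> mat_star_ring uniform_roe_algebra"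

lemma mat_roe_entry_closed:
  "a \<in> carrier (mat_roe n) \<Longrightarrow> i < n \<Longrightarrow> j < n \<Longrightarrow> a i j \<in> carrier uniform_roe_algebra"
  by (auto simp: mat_star_ring_def)

lemma mat_roe_add_entry:
  "i < n \<Longrightarrow> j < n \<Longrightarrow> (a \<oplus>\<^bsub>mat_roe n\<^esub> b) i j = a i j + b i j"
  by (simp add: mat_star_ring_def)

lemma mat_roe_star_entry:
  "i < n \<Longrightarrow> j < n \<Longrightarrow> star (mat_roe n) a i j = adj (a j i)"
  by (simp add: mat_star_ring_def)

lemma mat_roe_star_closed:
  "a \<in> carrier (mat_roe n) \<Longrightarrow> star (mat_roe n) a \<in> carrier (mat_roe n)"
  using mat_roe_entry_closed[of a n]
  by (auto simp: mat_star_ring_def uniform_roe_algebra_closed intro!: mat_of_closed)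

lemma mat_roe_mult_entry:
  assumes "a \<in> carrier (mat_roe n)" "b \<in> carrier (mat_roe n)" "i < n" "j < n"
  shows "(a \<otimes>\<^bsub>mat_roe n\<^esub> b) i j = (\<Sum>k<n. a i k o\<^sub>L b k j)"
proof -
  have "(a \<otimes>\<^bsub>mat_roe n\<^esub> b) i j = (\<Oplus>\<^bsub>uniform_roe_algebra\<^esub>k\<in>{..<n}. a i k o\<^sub>L b k j)"
    using assms by (simp add: mat_star_ring_def)
  also have "\<dots> = (\<Sum>k<n. a i k o\<^sub>L b k j)"
    using assms by (intro finsum_uniform_roe_algebra uniform_roe_algebra_closed mat_roe_entry_closed) auto
  finally show ?thesis .
qed

lemma cinner_sum_right: "cinner f (\<Sum>x\<in>F. h x) = (\<Sum>x\<in>F. cinner f (h x))"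
  by (induction F rule: infinite_finite_induct) (auto simp: cinner_simps)

text \<open>A diagonal entry of this product measures column \<open>j\<close> of \<open>a\<close>;
  with the factors exchanged, \<open>cinner_mat_roe_mult_star\<close> measures row \<open>i\<close>
  through adjoints.\<close>

lemma cinner_mat_roe_star_mult:
  assumes a: "a \<in> carrier (mat_roe n)" and j: "j < n"
  shows "cinner f ((star (mat_roe n) a \<otimes>\<^bsub>mat_roe n\<^esub> a) j j f) =
    complex_of_real (\<Sum>k<n. (norm (a k j f))\<^sup>2)"
proof -
  have "(star (mat_roe n) a \<otimes>\<^bsub>mat_roe n\<^esub> a) j j = (\<Sum>k<n. adj (a k j) o\<^sub>L a k j)"
    unfolding mat_roe_mult_entry[OF mat_roe_star_closed[OF a] a j j]
    by (intro sum.cong) (simp_all add: mat_roe_star_entry j)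
  then have "cinner f ((star (mat_roe n) a \<otimes>\<^bsub>mat_roe n\<^esub> a) j j f) =
      (\<Sum>k<n. cinner f ((adj (a k j) o\<^sub>L a k j) f))"
    by (simp add: blinfun.sum_left cinner_sum_right)
  also have "\<dots> = (\<Sum>k<n. complex_of_real ((norm (a k j f))\<^sup>2))"
    by (intro sum.cong norm_sq_compose_adj uniform_roe_algebra_clinear_op mat_roe_entry_closed[OF a] j) auto
  finally show ?thesis by simp
qed

lemma cinner_mat_roe_mult_star:
  assumes a: "a \<in> carrier (mat_roe n)" and i: "i < n"
  shows "cinner f ((a \<otimes>\<^bsub>mat_roe n\<^esub> star (mat_roe n) a) i i f) =
    complex_of_real (\<Sum>k<n. (norm (adj (a i k) f))\<^sup>2)"
proof -
  have "(a \<otimes>\<^bsub>mat_roe n\<^esub> star (mat_roe n) a) i i = (\<Sum>k<n. a i k o\<^sub>L adj (a i k))"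
    unfolding mat_roe_mult_entry[OF a mat_roe_star_closed[OF a] i i]
    by (intro sum.cong) (simp_all add: mat_roe_star_entry i)
  then have "cinner f ((a \<otimes>\<^bsub>mat_roe n\<^esub> star (mat_roe n) a) i i f) =
      (\<Sum>k<n. cinner f ((a i k o\<^sub>L adj (a i k)) f))"
    by (simp add: blinfun.sum_left cinner_sum_right)
  also have "\<dots> = (\<Sum>k<n. complex_of_real ((norm (adj (a i k) f))\<^sup>2))"
  proof (intro sum.cong refl)
    fix k assume "k \<in> {..<n}"
    then have lin: "clinear_op (a i k)"
      using uniform_roe_algebra_clinear_op mat_roe_entry_closed[OF a i] by blast
    show "cinner f ((a i k o\<^sub>L adj (a i k)) f) = complex_of_real ((norm (adj (a i k) f))\<^sup>2)"
      using norm_sq_compose_adj[OF clinear_op_adj[OF lin], of f] by (simp add: adj_adj[OF lin])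
  qed
  finally show ?thesis by simp
qed

lemma cinner_char_proj_basis:
  "cinner (basis_ell2 z) (char_proj A (basis_ell2 z)) = complex_of_real (indicator A z)"
  by (simp add: char_proj_basis cinner_basis ell2_fun_basis zero_ell2.rep_eq)

section \<open>Double counting of squared matrix coefficients\<close>

lemma properly_infinite_imp_paradoxical:
  fixes A :: "'a::metric_space set"
  assumes X: "bounded_geometry (UNIV :: 'a set)" and n: "1 \<le> n"
    and inf: "properly_infinite (mat_roe n) (mat_direct_sum uniform_roe_algebra n (char_proj A))"
  shows "paradoxical A"
proof -
  interpret M: abelian_group "mat_roe n :: (nat \<Rightarrow> nat \<Rightarrow> 'a ell2 \<Rightarrow>\<^sub>L 'a ell2) star_ring"
    by (intro abelian_group_mat_star_ring ring.is_abelian_group ring_uniform_roe_algebra)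
  define P where "P = mat_direct_sum uniform_roe_algebra n (char_proj A)"
  have P: "P i i = char_proj A" if "i < n" for i
    using that by (simp add: P_def mat_direct_sum_def)
  obtain x y where x: "x \<in> carrier (mat_roe n)" "star (mat_roe n) x \<otimes>\<^bsub>mat_roe n\<^esub> x = P"
    and y: "y \<in> carrier (mat_roe n)" "star (mat_roe n) y \<otimes>\<^bsub>mat_roe n\<^esub> y = P"
    and le: "star_le (mat_roe n) (x \<otimes>\<^bsub>mat_roe n\<^esub> star (mat_roe n) x \<oplus>\<^bsub>mat_roe n\<^esub>
      y \<otimes>\<^bsub>mat_roe n\<^esub> star (mat_roe n) y) P"
    using inf unfolding properly_infinite_def partial_isometry_def P_def by blast
  define U where "U = x \<otimes>\<^bsub>mat_roe n\<^esub> star (mat_roe n) x \<oplus>\<^bsub>mat_roe n\<^esub>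
      y \<otimes>\<^bsub>mat_roe n\<^esub> star (mat_roe n) y"
  obtain z where U: "U \<in> carrier (mat_roe n)" "P \<in> carrier (mat_roe n)"
    and z: "z \<in> carrier (mat_roe n)" "P \<ominus>\<^bsub>mat_roe n\<^esub> U = star (mat_roe n) z \<otimes>\<^bsub>mat_roe n\<^esub> z"
    using le unfolding star_le_def U_def by blast
  \<comment> \<open>The order relation is rewritten as a sum, whose positive first term can later be
    dropped.\<close>
  have dec: "P = star (mat_roe n) z \<otimes>\<^bsub>mat_roe n\<^esub> z \<oplus>\<^bsub>mat_roe n\<^esub> U"
    unfolding z(2)[symmetric] using U by (simp add: M.minus_eq M.a_assoc M.l_neg)
  have lin: "clinear_op (x i j)" "clinear_op (y i j)" if "i < n" "j < n" for i j
    using that uniform_roe_algebra_clinear_op mat_roe_entry_closed x(1) y(1) by blast+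

  have col: "(\<Sum>k<n. (norm (blinfun_apply (v k j) (basis_ell2 w)))\<^sup>2) = 1"
    if "v \<in> {x, y}" "j < n" "w \<in> A" for v j w
  proof -
    have "v \<in> carrier (mat_roe n)" "star (mat_roe n) v \<otimes>\<^bsub>mat_roe n\<^esub> v = P"
      using that x y by auto
    from cinner_mat_roe_star_mult[OF this(1) that(2), of "basis_ell2 w"] this(2)
    have "complex_of_real (\<Sum>k<n. (norm (v k j (basis_ell2 w)))\<^sup>2) = complex_of_real 1"
      using that cinner_char_proj_basis[of w A] by (simp add: P)
    then show ?thesis by (rule of_real_eq_iff[THEN iffD1])
  qed
  \<comment> \<open>Diagonal entry \<open>i\<close> of \<open>dec\<close> is tested on a basis
    vector and the contribution of \<open>z\<close> is discarded. For \<open>w\<close> outside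
    \<open>A\<close> the bound is 0, which is why only neighbours inside \<open>A\<close> will
    count.\<close>
  have row: "(\<Sum>k<n. (norm (adj (x i k) (basis_ell2 w)))\<^sup>2) +
      (\<Sum>k<n. (norm (adj (y i k) (basis_ell2 w)))\<^sup>2) \<le> indicator A w" if i: "i < n" for i w
  proof -
    let ?e = "basis_ell2 w"
    have "char_proj A = (star (mat_roe n) z \<otimes>\<^bsub>mat_roe n\<^esub> z) i i +
        ((x \<otimes>\<^bsub>mat_roe n\<^esub> star (mat_roe n) x) i i + (y \<otimes>\<^bsub>mat_roe n\<^esub> star (mat_roe n) y) i i)"
      using arg_cong[OF dec, of "\<lambda>a. a i i"] i by (simp add: P U_def mat_roe_add_entry)
    then have "cinner ?e (char_proj A ?e) = cinner ?e ((star (mat_roe n) z \<otimes>\<^bsub>mat_roe n\<^esub> z) i i ?e) +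
        (cinner ?e ((x \<otimes>\<^bsub>mat_roe n\<^esub> star (mat_roe n) x) i i ?e) +
         cinner ?e ((y \<otimes>\<^bsub>mat_roe n\<^esub> star (mat_roe n) y) i i ?e))"
      by (simp add: blinfun.add_left cinner_simps)
    then have "complex_of_real (indicator A w) = complex_of_real ((\<Sum>k<n. (norm (z k i ?e))\<^sup>2) +
        ((\<Sum>k<n. (norm (adj (x i k) ?e))\<^sup>2) + (\<Sum>k<n. (norm (adj (y i k) ?e))\<^sup>2)))"
      unfolding cinner_char_proj_basis cinner_mat_roe_star_mult[OF z(1) i]
        cinner_mat_roe_mult_star[OF x(1) i] cinner_mat_roe_mult_star[OF y(1) i] of_real_add .
    then have "indicator A w = (\<Sum>k<n. (norm (z k i ?e))\<^sup>2) +
        ((\<Sum>k<n. (norm (adj (x i k) ?e))\<^sup>2) + (\<Sum>k<n. (norm (adj (y i k) ?e))\<^sup>2))"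
      by (rule of_real_eq_iff[THEN iffD1])
    moreover have "0 \<le> (\<Sum>k<n. (norm (z k i ?e))\<^sup>2)" by (intro sum_nonneg) simp
    ultimately show ?thesis by linarith
  qed

  define c where "c T w v = (cmod (ell2_fun (blinfun_apply T (basis_ell2 v)) w))\<^sup>2"
    for T :: "'a ell2 \<Rightarrow>\<^sub>L 'a ell2" and w v
  \<comment> \<open>There are \<open>n\<close> squared entries in each of \<open>x\<close> and
    \<open>y\<close>, each losing at most \<open>e\<close>. The total loss is n/2, so 3n/2 of the
    mass 2n remains.\<close>
  define e where "e = 1 / (4 * real n)"
  have e: "0 < e" using n by (simp add: e_def)
  have "\<forall>\<^sub>F r in at_top. \<forall>i\<in>{..<n}. \<forall>j\<in>{..<n}. \<forall>v\<in>{x, y}. \<forall>u.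
      (norm (blinfun_apply (v i j) (basis_ell2 u)))\<^sup>2 - e \<le> (\<Sum>w\<in>cball u r. c (v i j) w u)"
    unfolding c_def using x(1) y(1)
    by (intro eventually_ball_finite ballI uniform_roe_algebra_truncation[OF X _ e])
      (auto intro: mat_roe_entry_closed)
  then obtain R where R: "\<And>i j v u. i < n \<Longrightarrow> j < n \<Longrightarrow> v \<in> {x, y} \<Longrightarrow>
      (norm (blinfun_apply (v i j) (basis_ell2 u)))\<^sup>2 - e \<le> (\<Sum>w\<in>cball u R. c (v i j) w u)"
    unfolding eventually_at_top_linorder by blast
  \<comment> \<open>The total mass that all entries of \<open>x\<close> and \<open>y\<close> place
    at position \<open>w\<close> of the column over \<open>u\<close>.\<close>
  define m where "m w u = (\<Sum>i<n. \<Sum>j<n. c (x i j) w u + c (y i j) w u)" for w u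
  have c0: "0 \<le> c T w u" for T w u by (simp add: c_def)
  have m0: "0 \<le> m w u" for w u unfolding m_def by (intro sum_nonneg add_nonneg_nonneg c0)

  have column: "3 / 2 * real n \<le> (\<Sum>w\<in>cball u R. m w u)" if u: "u \<in> A" for u
  proof -
    have "3 / 2 * real n = (\<Sum>j<n. (1 - real n * e) + (1 - real n * e))"
      using n by (simp add: e_def)
    also have "\<dots> = (\<Sum>j<n. (\<Sum>i<n. (norm (x i j (basis_ell2 u)))\<^sup>2 - e) +
        (\<Sum>i<n. (norm (y i j (basis_ell2 u)))\<^sup>2 - e))"
      using col[of x _ u] col[of y _ u] u by (simp add: sum_subtractf)
    also have "\<dots> = (\<Sum>i<n. \<Sum>j<n. ((norm (x i j (basis_ell2 u)))\<^sup>2 - e) + ((norm (y i j (basis_ell2 u)))\<^sup>2 - e))"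
      unfolding sum.distrib[symmetric] by (rule sum.swap)
    also have "\<dots> \<le> (\<Sum>i<n. \<Sum>j<n. (\<Sum>w\<in>cball u R. c (x i j) w u) + (\<Sum>w\<in>cball u R. c (y i j) w u))"
      by (intro sum_mono add_mono R) auto
    also have "\<dots> = (\<Sum>i<n. \<Sum>w\<in>cball u R. \<Sum>j<n. c (x i j) w u + c (y i j) w u)"
      unfolding sum.distrib[symmetric] by (intro sum.cong refl sum.swap)
    also have "\<dots> = (\<Sum>w\<in>cball u R. m w u)"
      unfolding m_def by (rule sum.swap)
    finally show ?thesis .
  qed
  have rows: "(\<Sum>u\<in>F. m w u) \<le> real n * indicator A w" if F: "finite F" for F w
  proof -
    \<comment> \<open>The sum over \<open>F\<close> is moved innermost so that
      \<open>bessel_row\<close> bounds it by full row norms; \<open>row\<close> then contributes at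
      most \<open>indicator A w\<close> for each of the \<open>n\<close> indices
      \<open>i\<close>.\<close>
    have "(\<Sum>u\<in>F. m w u) = (\<Sum>i<n. \<Sum>u\<in>F. \<Sum>j<n. c (x i j) w u + c (y i j) w u)"
      unfolding m_def by (rule sum.swap)
    also have "\<dots> = (\<Sum>i<n. \<Sum>j<n. \<Sum>u\<in>F. c (x i j) w u + c (y i j) w u)"
      by (intro sum.cong refl sum.swap)
    also have "\<dots> = (\<Sum>i<n. (\<Sum>j<n. \<Sum>u\<in>F. c (x i j) w u) + (\<Sum>j<n. \<Sum>u\<in>F. c (y i j) w u))"
      by (simp add: sum.distrib)
    also have "\<dots> \<le> (\<Sum>i<n. (\<Sum>j<n. (norm (adj (x i j) (basis_ell2 w)))\<^sup>2) +
        (\<Sum>j<n. (norm (adj (y i j) (basis_ell2 w)))\<^sup>2))"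
      unfolding c_def using F lin by (intro sum_mono add_mono bessel_row) auto
    also have "\<dots> \<le> (\<Sum>i<n. indicator A w)" by (intro sum_mono row) simp
    finally show ?thesis by simp
  qed

  show ?thesis
  proof (rule paradoxicalI_expansion[OF X])
    fix F assume F: "finite F" "F \<subseteq> A"
    define G where "G = (\<Union>u\<in>F. cball u R)"
    have G: "finite G" using F finite_cball[OF X] by (auto simp: G_def)
    \<comment> \<open>The mass over \<open>F\<close> is counted first by columns and then by rows.
      Rows outside \<open>A\<close> are empty, and the common factor \<open>n\<close> is positive
      and cancels.\<close>
    have "real (card F) * (3 / 2 * real n) = (\<Sum>u\<in>F. 3 / 2 * real n)" by simp
    also have "\<dots> \<le> (\<Sum>u\<in>F. \<Sum>w\<in>cball u R. m w u)" using F by (intro sum_mono column) auto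
    also have "\<dots> \<le> (\<Sum>u\<in>F. \<Sum>w\<in>G. m w u)"
      using G m0 by (intro sum_mono sum_mono2) (auto simp: G_def)
    also have "\<dots> = (\<Sum>w\<in>G. \<Sum>u\<in>F. m w u)" by (rule sum.swap)
    also have "\<dots> \<le> (\<Sum>w\<in>G. real n * indicator A w)" by (intro sum_mono rows F)
    also have "\<dots> = real n * real (card (A \<inter> G))"
      using G by (simp add: sum_distrib_left[symmetric] sum.If_cases indicator_def Int_commute)
    finally have "real n * (3 * real (card F)) \<le> real n * (2 * real (card (A \<inter> G)))"
      by (simp add: algebra_simps)
    then have "3 * real (card F) \<le> 2 * real (card (A \<inter> G))"
      using n by simp
    then show "3 * card F \<le> 2 * card (A \<inter> (\<Union>u\<in>F. cball u R))"
      unfolding G_def by linarith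
  qed
qed

section \<open>The equivalence of the four conditions\<close>

theorem proposition4p3:
  fixes A :: "'a::metric_space set"
  assumes "bounded_geometry (UNIV :: 'a set)"
  shows "(paradoxical A \<longleftrightarrow> properly_infinite uniform_roe_algebra (char_proj A)) \<and>
    (properly_infinite uniform_roe_algebra (char_proj A) \<longleftrightarrow>
      (\<forall>n\<ge>1. properly_infinite (mat_star_ring uniform_roe_algebra n)
        (mat_direct_sum uniform_roe_algebra n (char_proj A)))) \<and>
    ((\<forall>n\<ge>1. properly_infinite (mat_star_ring uniform_roe_algebra n)
        (mat_direct_sum uniform_roe_algebra n (char_proj A))) \<longleftrightarrow>
      (\<exists>n\<ge>1. properly_infinite (mat_star_ring uniform_roe_algebra n)
        (mat_direct_sum uniform_roe_algebra n (char_proj A))))"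
proof (intro conjI iffI)
  let ?inf = "\<lambda>n. properly_infinite (mat_star_ring uniform_roe_algebra n)
    (mat_direct_sum uniform_roe_algebra n (char_proj A))"
  \<comment> \<open>With \<open>base\<close> and \<open>ex\<close>, the facts \<open>up\<close> and
    \<open>down\<close> close a cycle: paradoxical, properly infinite, all \<open>n\<close>, some
    \<open>n\<close>, paradoxical. Each required implication is a path along this cycle.\<close>
  have up: "\<forall>n\<ge>1. ?inf n" if "properly_infinite uniform_roe_algebra (char_proj A)"
    using star_closed_ring.properly_infinite_mat_direct_sum[OF star_closed_ring_uniform_roe_algebra that]
    by blast
  have down: "paradoxical A" if "\<exists>n\<ge>1. ?inf n"
    using that properly_infinite_imp_paradoxical[OF assms] by blast
  note base = paradoxical_imp_properly_infinite[OF assms]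
  show ex: "\<exists>n\<ge>1. ?inf n" if "\<forall>n\<ge>1. ?inf n"
    using that by (intro exI[of _ 1]) simp
  show "properly_infinite uniform_roe_algebra (char_proj A)" if "paradoxical A"
    using that by (rule base)
  show "paradoxical A" if "properly_infinite uniform_roe_algebra (char_proj A)"
    using up[OF that] by (intro down ex)
  show "\<forall>n\<ge>1. ?inf n" if "properly_infinite uniform_roe_algebra (char_proj A)"
    using that by (rule up)
  show "properly_infinite uniform_roe_algebra (char_proj A)" if "\<forall>n\<ge>1. ?inf n"
    using that by (intro base down ex)
  show "\<forall>n\<ge>1. ?inf n" if "\<exists>n\<ge>1. ?inf n"
    using that by (intro up base down)
qed

end
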